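(* Let $H\in(0,1/2)$, $T>0$, and let $\{B^H_t\}_{t\in[0,T]}$ be a fractional Brownian motion with Hurst index $H$, i.e. a continuous centered Gaussian process with $E(B^H_tB^H_s)=\frac12\left(t^{2H}+s^{2H}-|t-s|^{2H}\right)$, considered with its natural filtration $\mathcal F_t=\sigma\{B^H_u:0\le u\le t\}$. Then for every sequence $\{\theta_n\}$ of normally condensing partitions of $[0,T]$, \[\sup_n E\big(A^{\theta_n}_T\big)^2=+\infty,\] where $A^{\theta_n}_T=\sum_{k=1}^{k^{\theta_n}}E\big(B^H_{t_k^{\theta_n}}-B^H_{t_{k-1}^{\theta_n}}\,\big|\,\mathcal F_{t_{k-1}^{\theta_n}}\big)$ is the terminal value of the predictable compensator of the discretization of $B^H$ on $\theta_n$. (In this sense $B^H$ admits no local predictor.)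
   Context: A sequence $\{\theta_n\}$ of partitions $0=t_0^{\theta_n}<t_1^{\theta_n}<\dots<t^{\theta_n}_{k^{\theta_n}}=T$ of $[0,T]$ is normally condensing if $\theta_n\subset\theta_{n+1}$ and the mesh $|\theta_n|=\max_k(t_k^{\theta_n}-t_{k-1}^{\theta_n})\to0$ as $n\to\infty$. *)

theory Defs
  imports "HOL-Probability.Probability"
begin

definition centered_gaussian :: "'a measure \<Rightarrow> ('a \<Rightarrow> real) \<Rightarrow> bool" where
  "centered_gaussian M Y \<longleftrightarrow>
     Y \<in> borel_measurable M \<and>
     ((\<exists>\<sigma>>0. distributed M lborel Y (normal_density 0 \<sigma>)) \<or> (AE \<omega> in M. Y \<omega> = 0))"

definition fBm :: "'a measure \<Rightarrow> real \<Rightarrow> real \<Rightarrow> (real \<Rightarrow> 'a \<Rightarrow> real) \<Rightarrow> bool" where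
  "fBm M H T B \<longleftrightarrow>
     (\<forall>t\<in>{0..T}. B t \<in> borel_measurable M) \<and>
     (AE \<omega> in M. continuous_on {0..T} (\<lambda>t. B t \<omega>)) \<and>
     (\<forall>S c. finite S \<longrightarrow> S \<subseteq> {0..T} \<longrightarrow>
         centered_gaussian M (\<lambda>\<omega>. \<Sum>t\<in>S. c t * B t \<omega>)) \<and>
     (\<forall>t\<in>{0..T}. \<forall>s\<in>{0..T}. integrable M (\<lambda>\<omega>. B t \<omega> * B s \<omega>) \<and>
         (\<integral>\<omega>. B t \<omega> * B s \<omega> \<partial>M) =
           (t powr (2*H) + s powr (2*H) - \<bar>t - s\<bar> powr (2*H)) / 2)"

text \<open>Natural filtration F_t = sigma{B_u : 0 <= u <= t}, as a measure (only its sets matter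
  for real_cond_exp).\<close>
definition natural_filtration :: "'a measure \<Rightarrow> (real \<Rightarrow> 'a \<Rightarrow> real) \<Rightarrow> real \<Rightarrow> 'a measure" where
  "natural_filtration M B t =
     sigma (space M) (\<Union>u\<in>{0..t}. {B u -` A \<inter> space M | A. A \<in> sets borel})"

definition part_pt :: "real set \<Rightarrow> nat \<Rightarrow> real" where
  "part_pt P k = sorted_list_of_set P ! k"

definition part_len :: "real set \<Rightarrow> nat" where
  "part_len P = card P - 1"

definition is_partition :: "real \<Rightarrow> real set \<Rightarrow> bool" where
  "is_partition T P \<longleftrightarrow> finite P \<and> P \<subseteq> {0..T} \<and> 0 \<in> P \<and> T \<in> P"

definition mesh :: "real set \<Rightarrow> real" where
  "mesh P = (if part_len P = 0 then 0
             else Max ((\<lambda>k. part_pt P k - part_pt P (k - 1)) ` {1..part_len P}))"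

definition normally_condensing :: "real \<Rightarrow> (nat \<Rightarrow> real set) \<Rightarrow> bool" where
  "normally_condensing T \<theta> \<longleftrightarrow>
     (\<forall>n. is_partition T (\<theta> n)) \<and> (\<forall>n. \<theta> n \<subseteq> \<theta> (Suc n)) \<and>
     (\<lambda>n. mesh (\<theta> n)) \<longlonglongrightarrow> 0"

definition compensator_T :: "'a measure \<Rightarrow> (real \<Rightarrow> 'a \<Rightarrow> real) \<Rightarrow> real set \<Rightarrow> 'a \<Rightarrow> real" where
  "compensator_T M B P \<omega> =
     (\<Sum>k=1..part_len P.
        real_cond_exp M (natural_filtration M B (part_pt P (k - 1)))
          (\<lambda>x. B (part_pt P k) x - B (part_pt P (k - 1)) x) \<omega>)"

end

theory Submission
  imports Defs
begin

text \<open>If \<open>N\<^sub>k\<close> denotes the difference between the \<open>k\<close>-th increment and its prediction, then the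
  \<open>N\<^sub>k\<close> are orthogonal and add up to \<open>B\<^sub>T - B\<^sub>0 - A\<close>, so it suffices that \<open>\<Sum>\<^sub>k E N\<^sub>k\<^sup>2\<close> tends to
  infinity. This follows from \<open>E N\<^sub>k\<^sup>2 \<ge> (1 - 2H)/2 \<Delta>\<^sub>k\<^sup>2\<^sup>H\<close> because \<open>2H < 1\<close>.

  For Gaussian processes the prediction is the \<open>L\<^sup>2\<close>-projection onto the closed linear span of the
  past, so the bound on \<open>E N\<^sub>k\<^sup>2\<close> only has to be checked against finite linear combinations. There
  one writes \<open>x\<^sup>2\<^sup>H\<close>, which is concave, as a positive mixture over \<open>h\<close> of the functions
  \<open>min x h\<close>. The quadratic form associated with \<open>min x h\<close> is the squared \<open>L\<^sup>2\<close> norm of a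
  combination of indicators of intervals of length \<open>h\<close>, and for \<open>h \<le> \<Delta>\<^sub>k\<close> only one of these
  intervals extends to the right of \<open>t\<^sub>k\<close>.\<close>

subsection \<open>A lower bound for the covariance form\<close>

text \<open>For \<open>x > 0\<close>, cutting the half-line at \<open>h = x\<close> gives
  \<open>x powr a / a\<close> from below, where \<open>min x h = h\<close>, and
  \<open>x powr a / (1 - a)\<close> from above, where it is \<open>x\<close>. Integrability at
  \<open>0\<close> rests on \<open>0 < a\<close>, at infinity on \<open>a < 1\<close>. It is applied
  with \<open>a = 2 * H\<close>.\<close>

lemma has_integral_powr_mult_min:
  fixes a x :: real
  assumes "0 < a" "a < 1" "0 \<le> x"
  shows "((\<lambda>h. h powr (a - 2) * min x h) has_integral (x powr a / (a * (1 - a)))) {0..}"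
proof (cases "x = 0")
  case True
  have "((\<lambda>h. h powr (a - 2) * min x h) has_integral 0) {0..}"
    by (rule has_integral_is_0) (use True in auto)
  then show ?thesis using True by simp
next
  case False
  with assms have x: "x > 0" by simp
  have "((\<lambda>h. h powr (a - 1)) has_integral (x powr (a - 1 + 1) / (a - 1 + 1))) {0..x}"
    by (rule has_integral_powr_from_0) (use assms in auto)
  then have I1: "((\<lambda>h. h powr (a - 2) * min x h) has_integral (x powr a / a)) {0..x}"
  proof (subst has_integral_cong)
    fix h assume h: "h \<in> {0..x}"
    have "h powr (a - 2) * h = h powr (a - 1)"
    \<comment> \<open>At \<open>h = 0\<close> both sides are \<open>0\<close>, because
      \<open>0 powr y = 0\<close> for every \<open>y\<close>.\<close>
    proof (cases "h = 0")
      case False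
      with h have "h powr (a - 2) * h powr 1 = h powr (a - 2 + 1)" by (metis powr_add)
      then show ?thesis using h False by (simp add: algebra_simps)
    qed auto
    then show "h powr (a - 2) * min x h = h powr (a - 1)" using h by (auto simp: min_def)
  qed simp
  have "((\<lambda>h. h powr (a - 2)) has_integral -(x powr (a - 2 + 1)) / (a - 2 + 1)) {x..}"
    by (rule has_integral_powr_to_inf) (use assms x in auto)
  then have "((\<lambda>h. h powr (a - 2) * x) has_integral -(x powr (a - 2 + 1)) / (a - 2 + 1) * x) {x..}"
    by (rule has_integral_mult_left)
  moreover have "-(x powr (a - 2 + 1)) / (a - 2 + 1) * x = x powr a / (1 - a)"
  proof -
    have "x powr (a - 1) * x powr 1 = x powr (a - 1 + 1)" by (metis powr_add)
    then show ?thesis using x assms by (simp add: field_simps)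
  qed
  ultimately have I2: "((\<lambda>h. h powr (a - 2) * min x h) has_integral (x powr a / (1 - a))) {x..}"
    by (subst has_integral_cong[of _ _ "\<lambda>h. h powr (a - 2) * x"]) (auto simp: min_def)
  have "((\<lambda>h. h powr (a - 2) * min x h) has_integral (x powr a / a + x powr a / (1 - a))) ({0..x} \<union> {x..})"
    by (rule has_integral_Un[OF I1 I2]) (use x in \<open>auto intro!: negligible_subset[of "{x}"]\<close>)
  moreover have "{0..x} \<union> {x..} = {0..}" using x by auto
  moreover have "x powr a / a + x powr a / (1 - a) = x powr a / (a * (1 - a))"
    using assms by (simp add: field_simps)
  ultimately show ?thesis by simp
qed

text \<open>Far apart windows do not overlap, and this is what truncates the distance at
  \<open>h\<close>.\<close>

lemma measure_lborel_Int_Icc_shift: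
  fixes u v h :: real
  assumes "0 \<le> h"
  shows "measure lborel ({u..u+h} \<inter> {v..v+h}) = h - min \<bar>u - v\<bar> h"
proof -
  have "{u..u+h} \<inter> {v..v+h} = {max u v..min u v + h}" by auto
  then show ?thesis using assms by (auto simp: min_def max_def abs_if)
qed

text \<open>Multiplying out gives four overlaps of windows of length \<open>h\<close>, and the four
  terms \<open>h\<close> cancel. Subtracting the window at \<open>0\<close> makes the family start
  at the zero function, as the process does. The kernel is twice the covariance with
  \<open>x powr (2 * H)\<close> replaced by \<open>min x h\<close>.\<close>

lemma integral_shifted_indicator_mult:
  fixes u v h :: real
  assumes "0 \<le> h" "0 \<le> u" "0 \<le> v"
  defines "\<phi> \<equiv> \<lambda>u x. indicator {u..u+h} x - indicator {0..h} x :: real"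
  shows "has_bochner_integral lborel (\<lambda>x. \<phi> u x * \<phi> v x)
           (min u h + min v h - min \<bar>u - v\<bar> h)"
proof -
  have hb: "has_bochner_integral lborel (\<lambda>x. indicator ({u..u+h} \<inter> {v..v+h}) x :: real)
              (h - min \<bar>u - v\<bar> h)" for u v
    unfolding measure_lborel_Int_Icc_shift[OF \<open>0 \<le> h\<close>, symmetric]
    by (rule has_bochner_integral_real_indicator) (simp_all add: emeasure_lborel_Icc_eq)
  have big: "has_bochner_integral lborel
      (\<lambda>x. (indicator ({u..u+h} \<inter> {v..v+h}) x - indicator ({u..u+h} \<inter> {0..0+h}) x)
           - (indicator ({0..0+h} \<inter> {v..v+h}) x - indicator ({0..0+h} \<inter> {0..0+h}) x) :: real)
      (((h - min \<bar>u - v\<bar> h) - (h - min \<bar>u - 0\<bar> h)) - ((h - min \<bar>0 - v\<bar> h) - (h - min \<bar>0 - 0\<bar> h)))"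
    by (intro has_bochner_integral_diff hb)
  have eq1: "(indicator ({u..u+h} \<inter> {v..v+h}) x - indicator ({u..u+h} \<inter> {0..0+h}) x)
           - (indicator ({0..0+h} \<inter> {v..v+h}) x - indicator ({0..0+h} \<inter> {0..0+h}) x) = \<phi> u x * \<phi> v x" for x
    unfolding \<phi>_def indicator_inter_arith add_0
    by (cases "x \<in> {0..h}") (simp_all only: indicator_simps, simp_all add: algebra_simps)
  have eq2: "((h - min \<bar>u - v\<bar> h) - (h - min \<bar>u - 0\<bar> h)) - ((h - min \<bar>0 - v\<bar> h) - (h - min \<bar>0 - 0\<bar> h))
      = min u h + min v h - min \<bar>u - v\<bar> h"
    using assms(1-3) by simp
  show ?thesis using big unfolding eq1 eq2 .
qed

text \<open>The form below is the \<open>L\<^sup>2\<close> norm of a combination of differences of indicators; to the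
  right of \<open>t\<close> only the indicator attached to \<open>t\<close> survives.\<close>

lemma tent_quadratic_form:
  fixes b :: "real \<Rightarrow> real" and h r s t :: real
  assumes S: "finite S" "S \<subseteq> {0..s}" and s: "0 \<le> s" and st: "s < t" and h: "0 \<le> h"
  defines "Q \<equiv> \<Sum>u\<in>insert t S. \<Sum>v\<in>insert t S. b u * b v * (min u h + min v h - min \<bar>u - v\<bar> h)"
  shows "0 \<le> Q" and "h \<le> t - s \<Longrightarrow> (b t)\<^sup>2 * h \<le> Q"
proof -
  define \<phi> :: "real \<Rightarrow> real \<Rightarrow> real" where "\<phi> = (\<lambda>u x. indicator {u..u+h} x - indicator {0..h} x)"
  define f where "f = (\<lambda>x. \<Sum>u\<in>insert t S. b u * \<phi> u x)"
  have nn: "0 \<le> u" if "u \<in> insert t S" for u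
    using that S st s by auto
  have sq: "(f x)\<^sup>2 = (\<Sum>u\<in>insert t S. \<Sum>v\<in>insert t S. b u * b v * (\<phi> u x * \<phi> v x))" for x
    unfolding f_def power2_eq_square sum_product by (intro sum.cong refl) (simp add: ac_simps)
  have hb: "has_bochner_integral lborel (\<lambda>x. (f x)\<^sup>2) Q"
    unfolding sq Q_def
    by (intro has_bochner_integral_sum has_bochner_integral_mult_right)
      (auto simp: \<phi>_def intro!: integral_shifted_indicator_mult nn h)
  show "0 \<le> Q"
    using hb by (metis has_bochner_integral_integral_eq integral_nonneg_AE AE_I2 zero_le_power2)
  assume "h \<le> t - s"
  \<comment> \<open>The interval is open on the left because the window at \<open>s\<close> ends
    exactly at \<open>t\<close> when \<open>h = t - s\<close>. The subtracted window
    \<open>{0..h}\<close> also ends by \<open>t\<close>, since \<open>s\<close> is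
    nonnegative.\<close>
  have f: "f x = b t" if "x \<in> {t<..t+h}" for x
  proof -
    have "\<phi> u x = 0" if "u \<in> S" for u
      using S that \<open>x \<in> {t<..t+h}\<close> \<open>h \<le> t - s\<close> s st by (auto simp: \<phi>_def indicator_def)
    moreover have "\<phi> t x = 1"
      using that \<open>h \<le> t - s\<close> s by (auto simp: \<phi>_def indicator_def)
    moreover have "t \<notin> S" using S st by auto
    ultimately show ?thesis using S by (simp add: f_def)
  qed
  have "has_bochner_integral lborel (\<lambda>x. (b t)\<^sup>2 * indicator {t<..t+h} x) ((b t)\<^sup>2 * measure lborel {t<..t+h})"
    by (intro has_bochner_integral_mult_right has_bochner_integral_real_indicator)
      (use h in \<open>simp_all add: emeasure_lborel_Ioc\<close>)
  then have hb2: "has_bochner_integral lborel (\<lambda>x. (b t)\<^sup>2 * indicator {t<..t+h} x) ((b t)\<^sup>2 * h)"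
    using h by simp
  show "(b t)\<^sup>2 * h \<le> Q"
    unfolding has_bochner_integral_integral_eq[OF hb2, symmetric] has_bochner_integral_integral_eq[OF hb, symmetric]
    by (intro integral_mono integrable.intros[OF hb] integrable.intros[OF hb2]) (auto simp: f indicator_def)
qed


text \<open>The tent bound is integrated against \<open>h powr (a - 2)\<close>, where
  \<open>a = 2 * H\<close>. The mixture turns the tent kernels into the power kernel times
  \<open>1 / C\<close>, while the lower bound contributes the integral of
  \<open>h powr (a - 1)\<close> over \<open>{0..t - s}\<close>.\<close>

lemma fBm_covariance_form_lower_bound:
  fixes H s t :: real and b :: "real \<Rightarrow> real"
  assumes H: "0 < H" "H < 1/2" and S: "finite S" "S \<subseteq> {0..s}" and s: "0 \<le> s" and st: "s < t"
  shows "(b t)\<^sup>2 * ((1 - 2*H) / 2 * (t - s) powr (2*H)) \<le>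
    (\<Sum>u\<in>insert t S. \<Sum>v\<in>insert t S.
       b u * b v * ((u powr (2*H) + v powr (2*H) - \<bar>u - v\<bar> powr (2*H)) / 2))"
proof -
  define a where "a = 2 * H"
  define k where "k = (\<lambda>h u v. min u h + min v h - min \<bar>u - v\<bar> h :: real)"
  define Q where "Q = (\<lambda>h. \<Sum>u\<in>insert t S. \<Sum>v\<in>insert t S. b u * b v * k h u v)"
  define C where "C = a * (1 - a)"
  have a: "0 < a" "a < 1" using H by (auto simp: a_def)
  then have C: "C > 0" by (simp add: C_def)
  have nn: "0 \<le> u" if "u \<in> insert t S" for u
    using that S st s by auto
  have "((\<lambda>h. b u * b v * (h powr (a - 2) * min u h + h powr (a - 2) * min v h - h powr (a - 2) * min \<bar>u - v\<bar> h))
      has_integral (b u * b v * (u powr a / C + v powr a / C - \<bar>u - v\<bar> powr a / C))) {0..}"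
    if "u \<in> insert t S" "v \<in> insert t S" for u v
    unfolding C_def
    by (intro has_integral_mult_right has_integral_diff has_integral_add has_integral_powr_mult_min)
      (use a nn that in auto)
  then have "((\<lambda>h. \<Sum>u\<in>insert t S. \<Sum>v\<in>insert t S. b u * b v * (h powr (a - 2) * min u h + h powr (a - 2) * min v h - h powr (a - 2) * min \<bar>u - v\<bar> h))
      has_integral (\<Sum>u\<in>insert t S. \<Sum>v\<in>insert t S. b u * b v * (u powr a / C + v powr a / C - \<bar>u - v\<bar> powr a / C))) {0..}"
    using S by (intro has_integral_sum) auto
  moreover have "(\<Sum>u\<in>insert t S. \<Sum>v\<in>insert t S. b u * b v * (h powr (a - 2) * min u h + h powr (a - 2) * min v h - h powr (a - 2) * min \<bar>u - v\<bar> h))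
      = h powr (a - 2) * Q h" for h
    unfolding Q_def k_def sum_distrib_left by (intro sum.cong refl) (simp add: algebra_simps)
  ultimately have I1: "((\<lambda>h. h powr (a - 2) * Q h) has_integral (\<Sum>u\<in>insert t S. \<Sum>v\<in>insert t S. b u * b v * (u powr a / C + v powr a / C - \<bar>u - v\<bar> powr a / C))) {0..}"
    by simp
  have "((\<lambda>h. (b t)\<^sup>2 * h powr (a - 1)) has_integral ((b t)\<^sup>2 * ((t - s) powr (a - 1 + 1) / (a - 1 + 1)))) {0..t - s}"
    by (intro has_integral_mult_right has_integral_powr_from_0) (use a st in auto)
  \<comment> \<open>Extension by zero puts both sides on the same half-line; beyond
    \<open>t - s\<close> only \<open>0 \<le> Q h\<close> is used.\<close>
  then have "((\<lambda>h. if h \<in> {0..t-s} then (b t)\<^sup>2 * h powr (a - 1) else 0) has_integral ((b t)\<^sup>2 * ((t - s) powr a / a))) {0..}"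
    by (subst has_integral_restrict) auto
  then have "(b t)\<^sup>2 * ((t - s) powr a / a) \<le> (\<Sum>u\<in>insert t S. \<Sum>v\<in>insert t S. b u * b v * (u powr a / C + v powr a / C - \<bar>u - v\<bar> powr a / C))"
  proof (rule has_integral_le[OF _ I1])
    fix h :: real assume h: "h \<in> {0..}"
    have "h powr (a - 1) = h powr (a - 2) * h"
    proof (cases "h = 0")
      case False
      with h have "h powr (a - 2) * h powr 1 = h powr (a - 2 + 1)" by (metis powr_add)
      then show ?thesis using h False by (simp add: algebra_simps)
    qed auto
    then show "(if h \<in> {0..t-s} then (b t)\<^sup>2 * h powr (a - 1) else 0) \<le> h powr (a - 2) * Q h"
    proof (cases "h \<in> {0..t-s}")
      case True
      have "h powr (a - 2) * ((b t)\<^sup>2 * h) \<le> h powr (a - 2) * Q h"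
        using tent_quadratic_form(2)[OF S s st, of h b] True
        by (intro mult_left_mono) (auto simp: Q_def k_def)
      then show ?thesis using True \<open>h powr (a - 1) = _\<close> by (simp add: mult.left_commute)
    next
      case False
      then show ?thesis using tent_quadratic_form(1)[OF S s st, of h b] h by (auto simp: Q_def k_def)
    qed
  qed
  \<comment> \<open>The factor \<open>C / 2\<close> cancels the constant of the mixture and supplies
    the one half of the covariance; it turns \<open>1 / a\<close> into
    \<open>(1 - a) / 2\<close>.\<close>
  then have "C / 2 * ((b t)\<^sup>2 * ((t - s) powr a / a)) \<le> C / 2 * (\<Sum>u\<in>insert t S. \<Sum>v\<in>insert t S. b u * b v * (u powr a / C + v powr a / C - \<bar>u - v\<bar> powr a / C))"
    using C by (intro mult_left_mono) auto
  moreover have "C / 2 * ((b t)\<^sup>2 * ((t - s) powr a / a)) = (b t)\<^sup>2 * ((1 - a) / 2 * (t - s) powr a)"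
    using a by (simp add: C_def)
  moreover have "C / 2 * (\<Sum>u\<in>insert t S. \<Sum>v\<in>insert t S. b u * b v * (u powr a / C + v powr a / C - \<bar>u - v\<bar> powr a / C))
     = (\<Sum>u\<in>insert t S. \<Sum>v\<in>insert t S. b u * b v * ((u powr a + v powr a - \<bar>u - v\<bar> powr a) / 2))"
    unfolding sum_distrib_left using C by (intro sum.cong refl) (simp add: field_simps)
  ultimately show ?thesis by (simp add: a_def)
qed

subsection \<open>Square-integrable and Gaussian variables\<close>

lemma integrable_mult_of_square:
  fixes f g :: "'a \<Rightarrow> real"
  assumes [measurable]: "f \<in> borel_measurable M" "g \<in> borel_measurable M"
    and f2: "integrable M (\<lambda>x. (f x)\<^sup>2)" and g2: "integrable M (\<lambda>x. (g x)\<^sup>2)"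
  shows "integrable M (\<lambda>x. f x * g x)"
proof (rule Bochner_Integration.integrable_bound[OF Bochner_Integration.integrable_add[OF f2 g2]])
  have "\<bar>f x * g x\<bar> \<le> (f x)\<^sup>2 + (g x)\<^sup>2" for x
  proof -
    have "0 \<le> (\<bar>f x\<bar> - \<bar>g x\<bar>)\<^sup>2" by simp
    then have "2 * (\<bar>f x\<bar> * \<bar>g x\<bar>) \<le> (f x)\<^sup>2 + (g x)\<^sup>2" by (simp add: power2_diff)
    moreover have "0 \<le> \<bar>f x\<bar> * \<bar>g x\<bar>" by simp
    ultimately show ?thesis by (simp only: abs_mult)
  qed
  then show "AE x in M. norm (f x * g x) \<le> norm ((f x)\<^sup>2 + (g x)\<^sup>2)" by simp
qed simp

section \<open>Elementary calculus with square-integrable functions\<close>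

definition L2 :: "'a measure \<Rightarrow> ('a \<Rightarrow> real) set" where
  "L2 M = {f. f \<in> borel_measurable M \<and> integrable M (\<lambda>x. (f x)\<^sup>2)}"

lemma L2_measurable: "f \<in> L2 M \<Longrightarrow> f \<in> borel_measurable M"
  and L2_square: "f \<in> L2 M \<Longrightarrow> integrable M (\<lambda>x. (f x)\<^sup>2)"
  by (auto simp: L2_def)

lemma L2_mult: "f \<in> L2 M \<Longrightarrow> g \<in> L2 M \<Longrightarrow> integrable M (\<lambda>x. f x * g x)"
  by (auto simp: L2_def intro: integrable_mult_of_square)

lemma L2_cmult: "f \<in> L2 M \<Longrightarrow> (\<lambda>x. c * f x) \<in> L2 M"
  by (auto simp: L2_def power_mult_distrib)

lemma L2_add:
  assumes "f \<in> L2 M" "g \<in> L2 M" shows "(\<lambda>x. f x + g x) \<in> L2 M"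
proof -
  have "integrable M (\<lambda>x. (f x)\<^sup>2 + (g x)\<^sup>2 + 2 * (f x * g x))"
    using assms L2_mult[OF assms] by (auto simp: L2_def)
  then show ?thesis using assms by (auto simp: L2_def power2_sum mult.assoc)
qed

lemma L2_diff: "f \<in> L2 M \<Longrightarrow> g \<in> L2 M \<Longrightarrow> (\<lambda>x. f x - g x) \<in> L2 M"
  using L2_add[of f M "\<lambda>x. -1 * g x"] L2_cmult[of g M "-1"] by simp

lemma L2_sum:
  "(\<And>i. i \<in> I \<Longrightarrow> f i \<in> L2 M) \<Longrightarrow> (\<lambda>x. \<Sum>i\<in>I. f i x) \<in> L2 M"
proof (induction I rule: infinite_finite_induct)
  case (insert i I)
  then show ?case using L2_add[of "f i" M "\<lambda>x. \<Sum>i\<in>I. f i x"] by simp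
qed (auto simp: L2_def)

lemma L2_square_add:
  assumes "f \<in> L2 M" "g \<in> L2 M"
  shows "(\<integral>x. (f x + g x)\<^sup>2 \<partial>M) = (\<integral>x. (f x)\<^sup>2 \<partial>M) + 2 * (\<integral>x. f x * g x \<partial>M) + (\<integral>x. (g x)\<^sup>2 \<partial>M)"
proof -
  have "(\<integral>x. (f x + g x)\<^sup>2 \<partial>M) = (\<integral>x. (f x)\<^sup>2 + 2 * (f x * g x) + (g x)\<^sup>2 \<partial>M)"
    by (intro Bochner_Integration.integral_cong refl) (simp add: power2_sum)
  then show ?thesis using L2_mult[OF assms] assms[THEN L2_square] by simp
qed

context prob_space
begin

lemma L2_integrable: "f \<in> L2 M \<Longrightarrow> integrable M f"
  by (auto simp: L2_def intro: square_integrable_imp_integrable)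

text \<open>Jensen's inequality, read off from the nonnegativity of the variance of
  \<open>\<bar>f\<bar>\<close>.\<close>

lemma L2_integral_abs_le:
  assumes "f \<in> L2 M"
  shows "(\<integral>x. \<bar>f x\<bar> \<partial>M)\<^sup>2 \<le> (\<integral>x. (f x)\<^sup>2 \<partial>M)"
proof -
  have f: "integrable M (\<lambda>x. \<bar>f x\<bar>)" using L2_integrable[OF assms] by simp
  have "0 \<le> (\<integral>x. (\<bar>f x\<bar> - (\<integral>x. \<bar>f x\<bar> \<partial>M))\<^sup>2 \<partial>M)" by simp
  also have "\<dots> = (\<integral>x. \<bar>f x\<bar>\<^sup>2 \<partial>M) - (\<integral>x. \<bar>f x\<bar> \<partial>M)\<^sup>2"
    by (rule variance_eq) (use f L2_square[OF assms] in auto)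
  finally show ?thesis by simp
qed

section \<open>Moments and characteristic functions of centered Gaussian variables\<close>

lemma centered_gaussian_square_integrable:
  assumes "centered_gaussian M Y"
  shows "Y \<in> L2 M"
proof -
  have [measurable]: "Y \<in> borel_measurable M" using assms by (simp add: centered_gaussian_def)
  consider \<sigma> where "\<sigma> > 0" "distributed M lborel Y (normal_density 0 \<sigma>)" | "AE x in M. Y x = 0"
    using assms by (auto simp: centered_gaussian_def)
  then have "integrable M (\<lambda>x. (Y x)\<^sup>2)"
  proof cases
    case 1
    have "integrable lborel (\<lambda>x. normal_density 0 \<sigma> x * (x - 0)\<^sup>2)"
      by (rule integrable_normal_moment[OF 1(1)])
    then show ?thesis
      using distributed_integrable[OF 1(2), of "\<lambda>x. x\<^sup>2"] by simp
  next
    case 2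
    have "integrable M (\<lambda>x. (Y x)\<^sup>2) \<longleftrightarrow> integrable M (\<lambda>x. 0::real)"
      by (rule integrable_cong_AE) (use 2 in auto)
    then show ?thesis by simp
  qed
  then show ?thesis by (simp add: L2_def)
qed

text \<open>After scaling, this is the standard normal characteristic function at
  \<open>\<sigma>\<close>. The argument \<open>1\<close> suffices because the formula is applied to
  whole linear combinations. The degenerate alternative fits with second moment
  \<open>0\<close>.\<close>

lemma centered_gaussian_char:
  assumes "centered_gaussian M Y"
  shows "(\<integral>x. iexp (Y x) \<partial>M) = complex_of_real (exp (- (\<integral>x. (Y x)\<^sup>2 \<partial>M) / 2))"
proof -
  have [measurable]: "Y \<in> borel_measurable M" using assms by (simp add: centered_gaussian_def)
  consider \<sigma> where "\<sigma> > 0" "distributed M lborel Y (normal_density 0 \<sigma>)" | "AE x in M. Y x = 0"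
    using assms by (auto simp: centered_gaussian_def)
  then show ?thesis
  proof cases
    case 1
    have V: "(\<integral>x. (Y x)\<^sup>2 \<partial>M) = \<sigma>\<^sup>2"
      using normal_distributed_variance[OF 1] normal_distributed_expectation[OF 1] by simp
    have "distributed M lborel (\<lambda>x. (Y x - 0) / \<sigma>) std_normal_density"
      using 1 normal_standard_normal_convert[OF 1(1)] by blast
    then have d: "distr M lborel (\<lambda>x. (Y x - 0) / \<sigma>) = std_normal_distribution"
      by (simp add: distributed_def)
    have "complex_of_real (exp (- (\<sigma>\<^sup>2) / 2)) = char std_normal_distribution \<sigma>"
      by (simp add: char_std_normal_distribution)
    also have "\<dots> = (\<integral>x. iexp (\<sigma> * ((Y x - 0) / \<sigma>)) \<partial>M)"
      unfolding char_def d[symmetric] by (subst integral_distr) auto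
    also have "\<dots> = (\<integral>x. iexp (Y x) \<partial>M)"
      using 1(1) by simp
    finally show ?thesis by (simp add: V)
  next
    case 2
    have "(\<integral>x. iexp (Y x) \<partial>M) = (\<integral>x. 1 \<partial>M)"
      by (rule integral_cong_AE) (use 2 in auto)
    moreover have "(\<integral>x. (Y x)\<^sup>2 \<partial>M) = (\<integral>x. 0 \<partial>M)"
      by (rule integral_cong_AE) (use 2 in auto)
    ultimately show ?thesis by (simp add: prob_space)
  qed
qed

text \<open>Differentiating E exp(i(sG + V)) = exp(-E[(sG + V)^2] / 2) at s = 0 gives |E[G exp(iV)]|
  = |E[GV]| exp(-E[V^2] / 2). Only the upper bound is kept, so difference quotients with explicit
  errors replace the derivative.\<close>

lemma gaussian_correlation_iexp_bound:
  fixes G V :: "'a \<Rightarrow> real"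
  assumes gauss: "\<And>a b. centered_gaussian M (\<lambda>x. a * G x + b * V x)"
  shows "cmod (\<integral>x. G x * iexp (V x) \<partial>M) \<le> \<bar>\<integral>x. G x * V x \<partial>M\<bar>"
proof -
  have G: "G \<in> L2 M" and V: "V \<in> L2 M"
    using gauss[of 1 0] gauss[of 0 1] by (auto dest: centered_gaussian_square_integrable)
  note [measurable] = G[THEN L2_measurable] V[THEN L2_measurable]
  define g where "g = (\<integral>x. (G x)\<^sup>2 \<partial>M)"
  define c where "c = (\<integral>x. G x * V x \<partial>M)"
  define v where "v = (\<integral>x. (V x)\<^sup>2 \<partial>M)"
  define I where "I = (\<integral>x. G x * iexp (V x) \<partial>M)"
  have iV: "integrable M (\<lambda>x. iexp (f x))" if "f \<in> borel_measurable M" for f :: "'a \<Rightarrow> real"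
    by (rule integrable_iexp) (use that in auto)
  have iG: "integrable M (\<lambda>x. G x * iexp (V x))"
    by (rule Bochner_Integration.integrable_bound[OF L2_integrable[OF G]]) (auto simp: norm_mult)
  have bound: "s * cmod I \<le> s * \<bar>c\<bar> + s\<^sup>2 * g" if s: "s > 0" for s
  proof -
    have var: "(\<integral>x. (s * G x + V x)\<^sup>2 \<partial>M) = s\<^sup>2 * g + 2 * s * c + v"
      by (subst L2_square_add[OF L2_cmult[OF G] V])
        (simp add: g_def c_def v_def power_mult_distrib mult.assoc)
    \<comment> \<open>\<open>D\<close> is compared with its linearization
      \<open>\<i> * s * I\<close>. The quadratic term of the variance and the Taylor remainder each
      cost \<open>s\<^sup>2 * g / 2\<close>, which together make up the \<open>s\<^sup>2 * g\<close>
      of \<open>bound\<close>.\<close>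
    define D where "D = (\<integral>x. iexp (s * G x + V x) \<partial>M) - (\<integral>x. iexp (V x) \<partial>M)"
    have exp_lip: "\<bar>exp (-p) - exp (-q)\<bar> \<le> \<bar>p - q\<bar>" if "0 \<le> p" "0 \<le> q" for p q :: real
    proof -
      have *: "exp (-p) - exp (-q) \<le> q - p" if "0 \<le> p" "p \<le> q" for p q :: real
      proof -
        have "1 - exp (p - q) \<le> q - p" using exp_ge_add_one_self[of "p - q"] by linarith
        moreover have "exp (-p) * (1 - exp (p - q)) \<le> 1 * (1 - exp (p - q))"
          by (intro mult_right_mono) (use that in auto)
        moreover have "exp (-p) * (1 - exp (p - q)) = exp (-p) - exp (-q)"
          by (simp add: algebra_simps flip: exp_add)
        ultimately show ?thesis by simp
      qed
      show ?thesis using *[of p q] *[of q p] that by (cases "p \<le> q") (auto simp: abs_if)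
    qed
    have "cmod D = \<bar>exp (- ((s\<^sup>2 * g + 2 * s * c + v) / 2)) - exp (- (v / 2))\<bar>"
    proof -
      have "D = complex_of_real (exp (- (s\<^sup>2 * g + 2 * s * c + v) / 2) - exp (- v / 2))"
        using centered_gaussian_char[OF gauss[of s 1]] centered_gaussian_char[OF gauss[of 0 1]]
        by (simp add: D_def var v_def)
      then show ?thesis by (simp only: norm_of_real minus_divide_left)
    qed
    also have "\<dots> \<le> \<bar>(s\<^sup>2 * g + 2 * s * c + v) / 2 - v / 2\<bar>"
    proof (rule exp_lip)
      have "0 \<le> (\<integral>x. (s * G x + V x)\<^sup>2 \<partial>M)" by simp
      then show "0 \<le> (s\<^sup>2 * g + 2 * s * c + v) / 2" unfolding var by simp
    qed (simp add: v_def)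
    also have "(s\<^sup>2 * g + 2 * s * c + v) / 2 - v / 2 = s\<^sup>2 * g / 2 + s * c" by (simp add: field_simps)
    also have "\<bar>s\<^sup>2 * g / 2 + s * c\<bar> \<le> \<bar>s\<^sup>2 * g / 2\<bar> + \<bar>s * c\<bar>" by (rule abs_triangle_ineq)
    also have "\<dots> = s\<^sup>2 * g / 2 + s * \<bar>c\<bar>" using s by (simp add: abs_mult g_def)
    finally have D: "cmod D \<le> s\<^sup>2 * g / 2 + s * \<bar>c\<bar>" .
    have i1: "integrable M (\<lambda>x. iexp (s * G x + V x))" by (rule iV) measurable
    have i2: "integrable M (\<lambda>x. iexp (V x))" by (rule iV) measurable
    have i3: "integrable M (\<lambda>x. \<i> * s * (G x * iexp (V x)))"
      by (rule Bochner_Integration.integrable_mult_right[where c="\<i> * s" and f="\<lambda>x. G x * iexp (V x)", OF iG])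
    have iR: "integrable M (\<lambda>x. iexp (s * G x + V x) - iexp (V x) - \<i> * s * (G x * iexp (V x)))"
      by (rule Bochner_Integration.integrable_diff[OF Bochner_Integration.integrable_diff[OF i1 i2] i3])
    have DI: "D - \<i> * s * I = (\<integral>x. iexp (s * G x + V x) - iexp (V x) - \<i> * s * (G x * iexp (V x)) \<partial>M)"
      unfolding D_def I_def using iG iV[of "\<lambda>x. s * G x + V x"] iV[of V] by simp
    have "cmod (D - \<i> * s * I) \<le> (\<integral>x. cmod (iexp (s * G x + V x) - iexp (V x) - \<i> * s * (G x * iexp (V x))) \<partial>M)"
      unfolding DI by (rule integral_norm_bound)
    also have "\<dots> \<le> (\<integral>x. (s * G x)\<^sup>2 / 2 \<partial>M)"
    proof (rule integral_mono)
      show "integrable M (\<lambda>x. cmod (iexp (s * G x + V x) - iexp (V x) - \<i> * s * (G x * iexp (V x))))"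
        by (rule integrable_norm[OF iR])
      show "integrable M (\<lambda>x. (s * G x)\<^sup>2 / 2)" using L2_square[OF L2_cmult[OF G]] by auto
      fix x
      have "iexp (s * G x + V x) - iexp (V x) - \<i> * s * (G x * iexp (V x))
          = iexp (V x) * (iexp (s * G x) - (1 + \<i> * complex_of_real (s * G x)))"
        by (simp add: algebra_simps exp_add)
      also have "cmod \<dots> = cmod (iexp (s * G x) - (1 + \<i> * complex_of_real (s * G x)))"
        by (simp add: norm_mult)
      also have "\<dots> \<le> (s * G x)\<^sup>2 / 2"
        using iexp_approx1[of "s * G x" 1] by (simp add: numeral_2_eq_2)
      finally show "cmod (iexp (s * G x + V x) - iexp (V x) - \<i> * s * (G x * iexp (V x))) \<le> (s * G x)\<^sup>2 / 2" .
    qed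
    also have "\<dots> = s\<^sup>2 * g / 2" by (simp add: power_mult_distrib g_def)
    finally have "cmod (D - \<i> * s * I) \<le> s\<^sup>2 * g / 2" .
    moreover have "cmod (\<i> * s * I) \<le> cmod D + cmod (D - \<i> * s * I)"
      using norm_triangle_ineq4[of D "D - \<i> * s * I"] by simp
    moreover have "cmod (\<i> * s * I) = s * cmod I" using s by (simp add: norm_mult)
    ultimately show ?thesis using D by simp
  qed
  \<comment> \<open>Dividing by \<open>s\<close> and then letting it decrease to \<open>0\<close>
    removes the second-order term.\<close>
  have "cmod I \<le> \<bar>c\<bar> + s * g" if "s > 0" for s
  proof -
    have "s * cmod I \<le> s * (\<bar>c\<bar> + s * g)"
      using bound[OF that] by (simp add: distrib_left power2_eq_square)
    then show ?thesis using that by simp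
  qed
  then have "\<forall>\<^sub>F s in at_right 0. cmod I \<le> \<bar>c\<bar> + s * g"
    by (auto simp: eventually_at_filter)
  moreover have "((\<lambda>s. \<bar>c\<bar> + s * g) \<longlongrightarrow> \<bar>c\<bar> + 0 * g) (at_right 0)"
    by (intro tendsto_intros)
  ultimately have "cmod I \<le> \<bar>c\<bar> + 0 * g"
    by (intro tendsto_lowerbound) auto
  then show ?thesis by (simp add: I_def c_def)
qed

section \<open>Fourier uniqueness on generated sigma-algebras\<close>

text \<open>The hypothesis says that the signed measure with density \<open>U\<close>, pushed
  forward by \<open>v\<close>, has vanishing Fourier transform. The contributions of the positive
  and negative parts of \<open>U\<close>, once normalized, have equal characteristic functions, so
  Levy's uniqueness theorem identifies them.\<close>

lemma integral_indicator_eq_0_of_fourier: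
  fixes U v :: "'a \<Rightarrow> real"
  assumes U: "integrable M U" and v[measurable]: "v \<in> borel_measurable M"
    and zero: "\<And>t. (\<integral>x. U x * iexp (t * v x) \<partial>M) = 0"
    and A[measurable]: "A \<in> sets borel"
  shows "(\<integral>x. U x * indicator A (v x) \<partial>M) = 0"
proof -
  note [measurable] = borel_measurable_integrable[OF U]
  define P where "P = (\<lambda>x. max 0 (U x))"
  define N where "N = (\<lambda>x. max 0 (- U x))"
  have UPN: "U x = P x - N x" for x by (auto simp: P_def N_def)
  have P: "integrable M P" "\<And>x. 0 \<le> P x" and N: "integrable M N" "\<And>x. 0 \<le> N x"
    unfolding P_def N_def using U by auto
  have [measurable]: "P \<in> borel_measurable M" "N \<in> borel_measurable M"
    using P N by auto
  define m where "m = (\<integral>x. P x \<partial>M)"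
  \<comment> \<open>Frequency \<open>0\<close> shows that \<open>P\<close> and \<open>N\<close> have
    the same mass, so one constant normalizes both.\<close>
  have "complex_of_real (\<integral>x. U x \<partial>M) = 0" using zero[of 0] by simp
  then have mN: "m = (\<integral>x. N x \<partial>M)" unfolding UPN m_def using P N by simp
  show ?thesis
  proof (cases "m = 0")
    \<comment> \<open>Mass zero cannot be normalized, but then \<open>U\<close> vanishes almost
      everywhere.\<close>
    case True
    then have "AE x in M. P x = 0" "AE x in M. N x = 0"
      using integral_nonneg_eq_0_iff_AE[of M P] integral_nonneg_eq_0_iff_AE[of M N] P N mN m_def by auto
    then have "AE x in M. U x * indicator A (v x) = 0" by eventually_elim (simp add: UPN)
    then show ?thesis by (simp add: integral_eq_zero_AE)
  next
    case False
    have "0 \<le> m" using P by (simp add: m_def)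
    with False have m: "m > 0" by simp
    define \<mu> where "\<mu> = (\<lambda>f. distr (density M (\<lambda>x. ennreal (f x / m))) borel v)"
    have rd: "real_distribution (\<mu> f)"
      if f: "integrable M f" "\<And>x. 0 \<le> f x" "(\<integral>x. f x \<partial>M) = m" for f
    proof -
      have [measurable]: "f \<in> borel_measurable M" using f by auto
      have "prob_space (density M (\<lambda>x. ennreal (f x / m)))"
      proof
        have "emeasure (density M (\<lambda>x. ennreal (f x / m))) (space (density M (\<lambda>x. ennreal (f x / m)))) =
            (\<integral>\<^sup>+x. ennreal (f x / m) \<partial>M)"
          by (simp add: emeasure_density cong: nn_integral_cong)
        also have "\<dots> = ennreal (\<integral>x. f x / m \<partial>M)"
          by (rule nn_integral_eq_integral) (use f m in auto)
        also have "\<dots> = 1" using f m by simp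
        finally show "emeasure (density M (\<lambda>x. ennreal (f x / m))) (space (density M (\<lambda>x. ennreal (f x / m)))) = 1" .
      qed
      then interpret D: prob_space "density M (\<lambda>x. ennreal (f x / m))" .
      show ?thesis unfolding \<mu>_def by (rule D.real_distribution_distr) simp
    qed
    have int\<mu>: "(\<integral>y. g y \<partial>\<mu> f) = (\<integral>x. (f x / m) *\<^sub>R g (v x) \<partial>M)"
      if "integrable M f" "\<And>x. 0 \<le> f x" "g \<in> borel_measurable borel"
      for f and g :: "real \<Rightarrow> 'b :: {banach, second_countable_topology}"
    proof -
      have [measurable]: "f \<in> borel_measurable M" "g \<in> borel_measurable borel" using that by auto
      show ?thesis
        unfolding \<mu>_def using that m by (simp add: integral_distr integral_density)
    qed
    have ie: "integrable M (\<lambda>x. f x * iexp (t * v x))" if "integrable M f" for f :: "'a \<Rightarrow> real" and t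
    proof -
      have [measurable]: "f \<in> borel_measurable M" using that by auto
      show ?thesis
        by (rule Bochner_Integration.integrable_bound[OF that]) (auto simp: norm_mult)
    qed
    have "char (\<mu> P) = char (\<mu> N)"
    proof
      fix t
      have "char (\<mu> f) t = (\<integral>x. f x * iexp (t * v x) \<partial>M) / m"
        if "integrable M f" "\<And>x. 0 \<le> f x" for f
        unfolding char_def using that
        by (subst int\<mu>) (auto simp: scaleR_conv_of_real field_simps simp flip: integral_divide_zero)
      moreover have "(\<integral>x. P x * iexp (t * v x) \<partial>M) = (\<integral>x. N x * iexp (t * v x) \<partial>M)"
      proof -
        have "(\<integral>x. P x * iexp (t * v x) \<partial>M) - (\<integral>x. N x * iexp (t * v x) \<partial>M) = (\<integral>x. U x * iexp (t * v x) \<partial>M)"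
          using ie[OF P(1), of t] ie[OF N(1), of t]
          by (subst Bochner_Integration.integral_diff[symmetric]) (auto simp: UPN algebra_simps)
        then show ?thesis using zero[of t] by simp
      qed
      ultimately show "char (\<mu> P) t = char (\<mu> N) t" using P N by simp
    qed
    then have "\<mu> P = \<mu> N"
      using P N mN by (intro Levy_uniqueness rd) (auto simp: m_def)
    then have "(\<integral>y. indicator A y \<partial>\<mu> P) = (\<integral>y. (indicator A y :: real) \<partial>\<mu> N)" by simp
    then have "(\<integral>x. (P x / m) *\<^sub>R indicator A (v x) \<partial>M) = (\<integral>x. (N x / m) *\<^sub>R (indicator A (v x) :: real) \<partial>M)"
      using P N by (subst (asm) (1 2) int\<mu>) auto
    then have "(\<integral>x. P x * indicator A (v x) \<partial>M) = (\<integral>x. N x * indicator A (v x) \<partial>M)"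
      using m by simp
    moreover have "integrable M (\<lambda>x. f x * indicator A (v x))" if "integrable M f" for f :: "'a \<Rightarrow> real"
    proof -
      have [measurable]: "f \<in> borel_measurable M" using that by auto
      show ?thesis
        by (rule Bochner_Integration.integrable_bound[OF that]) (auto simp: indicator_def)
    qed
    ultimately show ?thesis unfolding UPN using P N by (simp add: left_diff_distrib)
  qed
qed

text \<open>This serves complex weights such as \<open>indicator C x * (G x * iexp (V x))\<close>.
  Conjugating the hypothesis at \<open>-t\<close> transfers it to \<open>cnj (W x)\<close>, hence to
  the real part of \<open>W\<close>; the imaginary part is the real part of
  \<open>- \<i> * W x\<close>.\<close>

lemma complex_integral_indicator_eq_0_of_fourier:
  fixes W :: "'a \<Rightarrow> complex" and v :: "'a \<Rightarrow> real"
  assumes W: "integrable M W" and v[measurable]: "v \<in> borel_measurable M"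
    and zero: "\<And>t. (\<integral>x. W x * iexp (t * v x) \<partial>M) = 0"
    and A[measurable]: "A \<in> sets borel"
  shows "(\<integral>x. W x * indicator A (v x) \<partial>M) = 0"
proof -
  have Re0: "(\<integral>x. Re (W x) * indicator A (v x) \<partial>M) = 0"
    if W: "integrable M W" and zero: "\<And>t. (\<integral>x. W x * iexp (t * v x) \<partial>M) = 0" for W :: "'a \<Rightarrow> complex"
  proof (rule integral_indicator_eq_0_of_fourier[OF _ v _ A])
    show "integrable M (\<lambda>x. Re (W x))" using W by (rule integrable_Re)
    fix t
    have ie: "integrable M (\<lambda>x. f x * iexp (t * v x))" if "integrable M f" for f
    proof -
      have [measurable]: "f \<in> borel_measurable M" using that by auto
      show ?thesis
        by (rule Bochner_Integration.integrable_bound[OF that]) (auto simp: norm_mult)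
    qed
    have "(\<integral>x. cnj (W x) * iexp (t * v x) \<partial>M) = (\<integral>x. cnj (W x * iexp (- t * v x)) \<partial>M)"
      by (simp add: exp_cnj)
    also have "\<dots> = cnj (\<integral>x. W x * iexp (- t * v x) \<partial>M)" by (rule Bochner_Integration.integral_cnj)
    also have "\<dots> = 0" by (simp only: zero complex_cnj_zero)
    finally have "(\<integral>x. W x * iexp (t * v x) + cnj (W x) * iexp (t * v x) \<partial>M) = 0"
      using zero[of t] ie[OF W] ie[OF integrable_cnj[OF W]] by (simp del: integrable_cnj)
    moreover have "(\<lambda>x. W x * iexp (t * v x) + cnj (W x) * iexp (t * v x)) = (\<lambda>x. 2 * (Re (W x) * iexp (t * v x)))"
      by (simp add: complex_add_cnj mult.assoc flip: distrib_right)
    ultimately show "(\<integral>x. Re (W x) * iexp (t * v x) \<partial>M) = 0" by simp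
  qed
  have 1: "(\<integral>x. Re (W x) * indicator A (v x) \<partial>M) = 0"
    by (rule Re0[OF W zero])
  have 2: "(\<integral>x. Re (- \<i> * W x) * indicator A (v x) \<partial>M) = 0"
  proof (rule Re0)
    show "integrable M (\<lambda>x. - \<i> * W x)" using W by simp
    show "(\<integral>x. - \<i> * W x * iexp (t * v x) \<partial>M) = 0" for t
      using zero[of t] by (simp add: mult.assoc)
  qed
  have I: "integrable M (\<lambda>x. W x * indicator A (v x))"
  proof -
    have [measurable]: "W \<in> borel_measurable M" using W by auto
    show ?thesis
      by (rule Bochner_Integration.integrable_bound[OF W]) (auto simp: indicator_def)
  qed
  have ReI: "Re (W x * indicator A (v x)) = Re (W x) * indicator A (v x)"
    and ImI: "Im (W x * indicator A (v x)) = Re (- \<i> * W x) * indicator A (v x)" for x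
    by (cases "v x \<in> A"; simp)+
  show ?thesis
  proof (rule complex_eqI)
    have "Re (\<integral>x. W x * indicator A (v x) \<partial>M) = (\<integral>x. Re (W x * indicator A (v x)) \<partial>M)"
      by (rule integral_Re[OF I, symmetric])
    then show "Re (\<integral>x. W x * indicator A (v x) \<partial>M) = Re 0" using 1 by (simp only: ReI zero_complex.sel)
    have "Im (\<integral>x. W x * indicator A (v x) \<partial>M) = (\<integral>x. Im (W x * indicator A (v x)) \<partial>M)"
      by (rule integral_Im[OF I, symmetric])
    then show "Im (\<integral>x. W x * indicator A (v x) \<partial>M) = Im 0" using 2 by (simp only: ImI zero_complex.sel)
  qed
qed

text \<open>The sets \<open>C\<close> on which \<open>G\<close> is orthogonal to all \<open>e\<^sup>i\<^sup>V\<close> form a Dynkin system closed under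
  intersection with the generators; the sets preserving it by intersection then form a
  \<open>\<sigma>\<close>-algebra.\<close>

lemma integral_indicator_sigma_sets_eq_0_of_fourier:
  fixes G :: "'a \<Rightarrow> real" and \<V> \<U> :: "('a \<Rightarrow> real) set"
  assumes G: "integrable M G"
    and meas: "\<V> \<subseteq> borel_measurable M" and z: "(\<lambda>x. 0) \<in> \<V>" and UV: "\<U> \<subseteq> \<V>"
    and cl: "\<And>V u t. V \<in> \<V> \<Longrightarrow> u \<in> \<V> \<Longrightarrow> (\<lambda>x. V x + t * u x) \<in> \<V>"
    and zero: "\<And>V. V \<in> \<V> \<Longrightarrow> (\<integral>x. G x * iexp (V x) \<partial>M) = 0"
    and K: "K \<in> sigma_sets (space M) (\<Union>u\<in>\<U>. {u -` A \<inter> space M | A. A \<in> sets borel})"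
  shows "(\<integral>x. G x * indicator K x \<partial>M) = 0"
proof -
  note [measurable] = borel_measurable_integrable[OF G]
  define \<C> where "\<C> = {C \<in> sets M. \<forall>V\<in>\<V>. (\<integral>x. indicator C x * (G x * iexp (V x)) \<partial>M) = 0}"
  have int: "integrable M (\<lambda>x. indicator C x * (G x * iexp (V x)))" if "V \<in> \<V>" "C \<in> sets M" for V C
  proof -
    have [measurable]: "V \<in> borel_measurable M" using that meas by auto
    show ?thesis
      by (rule Bochner_Integration.integrable_bound[OF G]) (use that in \<open>auto simp: norm_mult indicator_def\<close>)
  qed
  have int1: "integrable M (\<lambda>x. G x * iexp (V x))" if "V \<in> \<V>" for V
    using int[OF that sets.top] by (simp add: indicator_def cong: Bochner_Integration.integrable_cong)
  have Csub: "C \<in> sets M" if "C \<in> \<C>" for C using that by (simp add: \<C>_def)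
  have Cdiff: "C - D \<in> \<C>" if "C \<in> \<C>" "D \<in> \<C>" "D \<subseteq> C" for C D
  proof -
    have "(\<integral>x. indicator (C - D) x * (G x * iexp (V x)) \<partial>M) = 0" if V: "V \<in> \<V>" for V
    proof -
      have "(\<integral>x. indicator (C - D) x * (G x * iexp (V x)) \<partial>M)
          = (\<integral>x. indicator C x * (G x * iexp (V x)) - indicator D x * (G x * iexp (V x)) \<partial>M)"
        using \<open>D \<subseteq> C\<close> by (intro Bochner_Integration.integral_cong) (auto simp: indicator_def)
      also have "\<dots> = 0"
        using that \<open>C \<in> \<C>\<close> \<open>D \<in> \<C>\<close> int[OF V, of C] int[OF V, of D] by (simp add: \<C>_def)
      finally show ?thesis .
    qed
    then show ?thesis using that by (auto simp: \<C>_def)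
  qed
  have CUN: "(\<Union>i. D i) \<in> \<C>" if D: "disjoint_family D" "range D \<subseteq> \<C>" for D :: "nat \<Rightarrow> 'a set"
  proof -
    have DM: "D i \<in> sets M" for i using D Csub by auto
    have scale: "indicator S x *\<^sub>R z = indicator S x * z" for S :: "'a set" and x and z :: complex
      by (simp add: indicator_def)
    have "(\<integral>x. indicator (\<Union>i. D i) x * (G x * iexp (V x)) \<partial>M) = 0" if V: "V \<in> \<V>" for V
    proof -
      have "(\<integral>x\<in>(\<Union>i. D i). (G x * iexp (V x)) \<partial>M) = (\<Sum>i. (\<integral>x\<in>D i. (G x * iexp (V x)) \<partial>M))"
      proof (rule lebesgue_integral_countable_add[OF DM])
        show "D i \<inter> D j = {}" if "i \<noteq> j" for i j
          using D that by (auto simp: disjoint_family_on_def)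
        show "set_integrable M (\<Union>i. D i) (\<lambda>x. G x * iexp (V x))"
          unfolding set_integrable_def
          using int1[OF V] DM by (intro integrable_mult_indicator) auto
      qed
      also have "(\<lambda>i. (\<integral>x\<in>D i. (G x * iexp (V x)) \<partial>M)) = (\<lambda>i. 0)"
        using D V unfolding set_lebesgue_integral_def by (auto simp: \<C>_def scale fun_eq_iff subset_iff)
      finally show ?thesis unfolding set_lebesgue_integral_def by (simp add: scale)
    qed
    then show ?thesis using DM by (auto simp: \<C>_def)
  qed
  \<comment> \<open>Because \<open>\<C>\<close> tests against every member of \<open>\<V>\<close>,
    the factor \<open>iexp (t * u x)\<close> is absorbed by passing from \<open>V\<close> to
    \<open>V + t * u\<close>. Fourier uniqueness then trades these exponentials for the indicator of
    \<open>A\<close>.\<close>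
  have Cgen: "C \<inter> (u -` A \<inter> space M) \<in> \<C>" if C: "C \<in> \<C>" and u: "u \<in> \<V>" and A: "A \<in> sets borel" for C u A
  proof -
    have [measurable]: "u \<in> borel_measurable M" using u meas by auto
    have "(\<integral>x. indicator (C \<inter> (u -` A \<inter> space M)) x * (G x * iexp (V x)) \<partial>M) = 0" if V: "V \<in> \<V>" for V
    proof -
      have "(\<integral>x. indicator (C \<inter> (u -` A \<inter> space M)) x * (G x * iexp (V x)) \<partial>M)
          = (\<integral>x. (indicator C x * (G x * iexp (V x))) * indicator A (u x) \<partial>M)"
        by (intro Bochner_Integration.integral_cong) (auto simp: indicator_def)
      also have "\<dots> = 0"
      proof (rule complex_integral_indicator_eq_0_of_fourier[OF int[OF V Csub[OF C]] _ _ A])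
        fix t
        have "(\<integral>x. indicator C x * (G x * iexp (V x + t * u x)) \<partial>M) = 0"
          using C cl[OF V u, of t] by (auto simp: \<C>_def)
        then show "(\<integral>x. indicator C x * (G x * iexp (V x)) * iexp (t * u x) \<partial>M) = 0"
          by (simp add: exp_add distrib_left mult.assoc)
      qed simp
      finally show ?thesis .
    qed
    moreover have "C \<inter> (u -` A \<inter> space M) \<in> sets M"
      using C A by (auto simp: \<C>_def)
    ultimately show ?thesis by (simp add: \<C>_def)
  qed
  define \<K> where "\<K> = {K. K \<subseteq> space M \<and> (\<forall>C\<in>\<C>. C \<inter> K \<in> \<C>)}"
  interpret Dynkin_system "space M" \<K>
  proof (rule Dynkin_systemI)
    show "space M \<in> \<K>"
      using Csub sets.sets_into_space by (auto simp: \<K>_def Int_absorb2)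
    show "space M - K \<in> \<K>" if "K \<in> \<K>" for K
    proof -
      have "C \<inter> (space M - K) \<in> \<C>" if "C \<in> \<C>" for C
      proof -
        have "C \<inter> (space M - K) = C - C \<inter> K" using sets.sets_into_space[OF Csub[OF that]] by auto
        then show ?thesis using Cdiff[OF that, of "C \<inter> K"] that \<open>K \<in> \<K>\<close> by (auto simp: \<K>_def)
      qed
      then show ?thesis by (auto simp: \<K>_def)
    qed
    show "(\<Union>i. D i) \<in> \<K>" if D: "disjoint_family D" "range D \<subseteq> \<K>" for D :: "nat \<Rightarrow> 'a set"
    proof -
      have "C \<inter> (\<Union>i. D i) \<in> \<C>" if "C \<in> \<C>" for C
      proof -
        have "(\<Union>i. C \<inter> D i) \<in> \<C>"
          using D that by (intro CUN) (auto simp: disjoint_family_on_def \<K>_def)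
        then show ?thesis by simp
      qed
      then show ?thesis using D by (auto simp: \<K>_def)
    qed
  qed (auto simp: \<K>_def)
  \<comment> \<open>Stability under intersection is associativity,
    \<open>C \<inter> (K \<inter> K') = (C \<inter> K) \<inter> K'\<close>, so the generators
    themselves need not be stable under intersection.\<close>
  have "sigma_algebra (space M) \<K>"
    unfolding sigma_algebra_eq_Int_stable Int_stable_def by (auto simp: \<K>_def simp flip: Int_assoc)
  then have "sigma_sets (space M) (\<Union>u\<in>\<U>. {u -` A \<inter> space M | A. A \<in> sets borel}) \<subseteq> \<K>"
    using Cgen UV by (intro sigma_algebra.sigma_sets_subset) (auto simp: \<K>_def)
  moreover have "space M \<in> \<C>"
  proof -
    have "(\<integral>x. indicator (space M) x * (G x * iexp (V x)) \<partial>M) = (\<integral>x. G x * iexp (V x) \<partial>M)" for V :: "'a \<Rightarrow> real"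
      by (intro Bochner_Integration.integral_cong) auto
    then show ?thesis using zero by (simp add: \<C>_def)
  qed
  ultimately have "space M \<inter> K \<in> \<C>" "K \<subseteq> space M" using K by (auto simp: \<K>_def)
  \<comment> \<open>Taking the zero function in \<open>\<V>\<close> removes the exponential.\<close>
  then have "(\<integral>x. indicator K x * (G x * iexp 0) \<partial>M) = 0"
    using z by (auto simp: \<C>_def Int_absorb1)
  moreover have "(\<lambda>x. indicator K x * (G x * iexp 0)) = (\<lambda>x. complex_of_real (G x * indicator K x))"
    by (auto simp: indicator_def fun_eq_iff)
  ultimately have "(\<integral>x. complex_of_real (G x * indicator K x) \<partial>M) = 0" by simp
  then show ?thesis by (simp only: integral_complex_of_real of_real_eq_0_iff)
qed

end

subsection \<open>Prediction in Gaussian spaces\<close>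

text \<open>Gaussianity enters only through the vanishing of \<open>E[(X - Z) e\<^sup>i\<^sup>V]\<close> for the
  \<open>L\<^sup>2\<close>-projection \<open>Z\<close> of \<open>X\<close> onto the closure of \<open>\<V>\<close>, which identifies \<open>Z\<close> with the
  conditional expectation.\<close>

lemma (in prob_space) gaussian_prediction_error:
  fixes X :: "'a \<Rightarrow> real" and \<V> \<U> :: "('a \<Rightarrow> real) set"
  assumes gauss: "\<And>V a b. V \<in> \<V> \<Longrightarrow> centered_gaussian M (\<lambda>x. a * X x + b * V x)"
    and z: "(\<lambda>x. 0) \<in> \<V>" and UV: "\<U> \<subseteq> \<V>"
    and cl: "\<And>V u t. V \<in> \<V> \<Longrightarrow> u \<in> \<V> \<Longrightarrow> (\<lambda>x. V x + t * u x) \<in> \<V>"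
    and F: "subalgebra M F"
    and setsF: "sets F = sigma_sets (space M) (\<Union>u\<in>\<U>. {u -` A \<inter> space M | A. A \<in> sets borel})"
    and VF: "\<V> \<subseteq> borel_measurable F"
    and lower: "\<And>V. V \<in> \<V> \<Longrightarrow> c \<le> (\<integral>x. (X x - V x)\<^sup>2 \<partial>M)"
  shows "real_cond_exp M F X \<in> L2 M"
    and "c \<le> (\<integral>x. (X x - real_cond_exp M F X x)\<^sup>2 \<partial>M)"
proof -
  interpret F: finite_measure_subalgebra M F
    by unfold_locales (rule F)
  have X: "X \<in> L2 M"
    using centered_gaussian_square_integrable[OF gauss[OF z, of 1 0]] by simp
  have VL2: "V \<in> L2 M" if "V \<in> \<V>" for V
    using centered_gaussian_square_integrable[OF gauss[OF that, of 0 1]] by simp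
  have clmult: "(\<lambda>x. t * V x) \<in> \<V>" if "V \<in> \<V>" for V t
    using cl[OF z that, of t] by simp
  define err where "err = (\<lambda>V. \<integral>x. (X x - V x)\<^sup>2 \<partial>M)"
  define d where "d = Inf (err ` \<V>)"
  have bdd: "bdd_below (err ` \<V>)" by (rule bdd_belowI[of _ c]) (use lower in \<open>auto simp: err_def\<close>)
  have d_le: "d \<le> err V" if "V \<in> \<V>" for V
    unfolding d_def by (rule cInf_lower) (use that bdd in auto)
  have c_d: "c \<le> d" unfolding d_def
    by (rule cInf_greatest) (use z lower in \<open>auto simp: err_def\<close>)
  define \<epsilon> where "\<epsilon> = (\<lambda>n. inverse (real (Suc n)))"
  have \<epsilon>: "\<epsilon> n > 0" for n by (simp add: \<epsilon>_def)
  have \<epsilon>0: "\<epsilon> \<longlonglongrightarrow> 0" unfolding \<epsilon>_def by (rule LIMSEQ_inverse_real_of_nat)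
  have \<epsilon>dec: "\<epsilon> m \<le> \<epsilon> n" if "n \<le> m" for n m using that by (simp add: \<epsilon>_def)
  have "\<exists>V\<in>\<V>. err V < d + \<epsilon> n" for n
    using cInf_lessD[of "err ` \<V>" "d + \<epsilon> n"] z \<epsilon>[of n] by (auto simp: d_def)
  then obtain L where L: "\<And>n. L n \<in> \<V>" and errL: "\<And>n. err (L n) < d + \<epsilon> n" by metis
  have LL2: "L n \<in> L2 M" for n by (rule VL2[OF L])
  have RL2: "(\<lambda>x. X x - L n x) \<in> L2 M" for n by (rule L2_diff[OF X LL2])
  \<comment> \<open>An almost minimizer is almost orthogonal to \<open>\<V>\<close>: moving from
    \<open>L n\<close> along \<open>V\<close> cannot gain more than \<open>\<epsilon> n\<close>.
    Steps of size plus and minus \<open>sqrt (\<epsilon> n)\<close> make this slack and the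
    quadratic term of the same order.\<close>
  have corr: "\<bar>\<integral>x. (X x - L n x) * V x \<partial>M\<bar> \<le> sqrt (\<epsilon> n) * ((1 + (\<integral>x. (V x)\<^sup>2 \<partial>M)) / 2)"
    if V: "V \<in> \<V>" for V n
  proof -
    define k where "k = (\<integral>x. (X x - L n x) * V x \<partial>M)"
    define v where "v = (\<integral>x. (V x)\<^sup>2 \<partial>M)"
    have e: "d \<le> err (L n) + 2 * t * k + t\<^sup>2 * v" for t
    proof -
      have "d \<le> err (\<lambda>x. L n x + (-t) * V x)" by (rule d_le[OF cl[OF L V]])
      also have "\<dots> = (\<integral>x. ((X x - L n x) + t * V x)\<^sup>2 \<partial>M)"
        unfolding err_def by (intro Bochner_Integration.integral_cong refl) (simp add: algebra_simps)
      also have "\<dots> = err (L n) + 2 * t * k + t\<^sup>2 * v"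
        by (subst L2_square_add[OF RL2 L2_cmult[OF VL2[OF V]]])
          (simp add: err_def k_def v_def power_mult_distrib mult.left_commute)
      finally show ?thesis .
    qed
    define s where "s = sqrt (\<epsilon> n)"
    have s: "s > 0" "s\<^sup>2 = \<epsilon> n" using \<epsilon>[of n] by (auto simp: s_def)
    have "2 * s * \<bar>k\<bar> \<le> s\<^sup>2 * (1 + v)"
      using e[of s] e[of "-s"] errL[of n] s by (auto simp: abs_if algebra_simps)
    then have "s * \<bar>k\<bar> \<le> s * (s * ((1 + v) / 2))" by (simp add: power2_eq_square)
    then have "\<bar>k\<bar> \<le> s * ((1 + v) / 2)" using s(1) by (simp only: mult_le_cancel_left_pos)
    then show ?thesis by (simp add: k_def v_def s_def)
  qed
  \<comment> \<open>Parallelogram identity: the midpoint of two almost minimizers lies in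
    \<open>\<V>\<close>, so its error is at least \<open>d\<close>.\<close>
  have cauchy2: "(\<integral>x. (L n x - L m x)\<^sup>2 \<partial>M) \<le> 2 * (\<epsilon> n + \<epsilon> m)" for n m
  proof -
    define mid where "mid = (\<lambda>x. 1/2 * L n x + 1/2 * L m x)"
    have mid: "mid \<in> \<V>" unfolding mid_def by (rule cl[OF clmult[OF L] L])
    have "(\<integral>x. (L n x - L m x)\<^sup>2 + 4 * (X x - mid x)\<^sup>2 \<partial>M) = (\<integral>x. 2 * (X x - L n x)\<^sup>2 + 2 * (X x - L m x)\<^sup>2 \<partial>M)"
      by (intro Bochner_Integration.integral_cong refl) (simp add: mid_def power2_eq_square field_simps)
    then have "(\<integral>x. (L n x - L m x)\<^sup>2 \<partial>M) + 4 * err mid = 2 * err (L n) + 2 * err (L m)"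
      using L2_square[OF L2_diff[OF LL2[of n] LL2[of m]]] L2_square[OF L2_diff[OF X VL2[OF mid]]]
        L2_square[OF RL2[of n]] L2_square[OF RL2[of m]] by (simp add: err_def)
    then show ?thesis using d_le[OF mid] errL[of n] errL[of m] by simp
  qed
  have cauchy1: "\<exists>N. \<forall>i\<ge>N. \<forall>j\<ge>N. (\<integral>x. norm (L i x - L j x) \<partial>M) < e" if "e > 0" for e
  proof -
    have "\<forall>\<^sub>F n in sequentially. \<epsilon> n < e\<^sup>2 / 4"
      by (rule order_tendstoD(2)[OF \<epsilon>0]) (use that in simp)
    then obtain N where N: "\<And>n. n \<ge> N \<Longrightarrow> \<epsilon> n < e\<^sup>2 / 4" by (auto simp: eventually_sequentially)
    have "(\<integral>x. norm (L i x - L j x) \<partial>M) < e" if "i \<ge> N" "j \<ge> N" for i j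
    proof -
      have "(\<integral>x. \<bar>L i x - L j x\<bar> \<partial>M)\<^sup>2 < e\<^sup>2"
        using L2_integral_abs_le[OF L2_diff[OF LL2[of i] LL2[of j]]] cauchy2[of i j] N[OF that(1)] N[OF that(2)]
        by simp
      then show ?thesis using \<open>e > 0\<close> by (simp add: power_less_imp_less_base)
    qed
    then show ?thesis by blast
  qed
  obtain r where r: "strict_mono r" "AE x in M. Cauchy (\<lambda>i. L (r i) x)"
    by (rule cauchy_L1_AE_cauchy_subseq[OF L2_integrable[OF LL2] cauchy1])
  \<comment> \<open>As a limit formed at every point, \<open>Z\<close> is measurable for
    \<open>F\<close> itself, although convergence is known only almost everywhere.\<close>
  define Z where "Z = (\<lambda>x. lim (\<lambda>i. L (r i) x))"
  have LF[measurable]: "L n \<in> borel_measurable F" for n using L VF by auto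
  have ZF[measurable]: "Z \<in> borel_measurable F"
    unfolding Z_def by (rule borel_measurable_lim_metric) (rule LF)
  have [measurable]: "X \<in> borel_measurable M" "L n \<in> borel_measurable M" "Z \<in> borel_measurable M" for n
    using X LL2 measurable_from_subalg[OF F ZF] by (auto dest: L2_measurable)
  have lim: "AE x in M. (\<lambda>i. L (r i) x) \<longlonglongrightarrow> Z x"
    using r(2) by eventually_elim (auto simp: Z_def convergent_LIMSEQ_iff dest: Cauchy_convergent)
  \<comment> \<open>\<open>Z\<close> inherits the Cauchy estimate by Fatou's lemma along the
    subsequence; \<open>n \<le> r i\<close> gives
    \<open>\<epsilon> (r i) \<le> \<epsilon> n\<close>, hence the bound
    \<open>4 * \<epsilon> n\<close>.\<close>
  have fatou: "(\<integral>\<^sup>+x. ennreal ((L n x - Z x)\<^sup>2) \<partial>M) \<le> ennreal (4 * \<epsilon> n)" for n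
  proof -
    have "(\<integral>\<^sup>+x. ennreal ((L n x - Z x)\<^sup>2) \<partial>M) = (\<integral>\<^sup>+x. liminf (\<lambda>i. ennreal ((L n x - L (r i) x)\<^sup>2)) \<partial>M)"
    proof (rule nn_integral_cong_AE, use lim in eventually_elim)
      fix x assume "(\<lambda>i. L (r i) x) \<longlonglongrightarrow> Z x"
      then have "(\<lambda>i. ennreal ((L n x - L (r i) x)\<^sup>2)) \<longlonglongrightarrow> ennreal ((L n x - Z x)\<^sup>2)"
        by (intro tendsto_intros)
      then show "ennreal ((L n x - Z x)\<^sup>2) = liminf (\<lambda>i. ennreal ((L n x - L (r i) x)\<^sup>2))"
        by (metis lim_imp_Liminf sequentially_bot)
    qed
    also have "\<dots> \<le> liminf (\<lambda>i. \<integral>\<^sup>+x. ennreal ((L n x - L (r i) x)\<^sup>2) \<partial>M)"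
      by (rule nn_integral_liminf) simp
    also have "\<dots> \<le> liminf (\<lambda>i. ennreal (4 * \<epsilon> n))"
    proof (rule Liminf_mono, rule eventually_sequentiallyI)
      fix i assume "n \<le> i"
      then have "n \<le> r i" using seq_suble[OF r(1), of i] by simp
      then have "(\<integral>x. (L n x - L (r i) x)\<^sup>2 \<partial>M) \<le> 4 * \<epsilon> n"
        using cauchy2[of n "r i"] \<epsilon>dec[of n "r i"] by simp
      then show "(\<integral>\<^sup>+x. ennreal ((L n x - L (r i) x)\<^sup>2) \<partial>M) \<le> ennreal (4 * \<epsilon> n)"
        by (subst nn_integral_eq_integral) (auto intro!: L2_square L2_diff LL2 ennreal_leI)
    qed
    also have "\<dots> = ennreal (4 * \<epsilon> n)" by (simp add: Liminf_const)
    finally show ?thesis .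
  qed
  have LZ: "(\<lambda>x. L n x - Z x) \<in> L2 M" for n
    unfolding L2_def using fatou[of n] by (auto intro!: integrableI_bounded simp: less_top[symmetric] top_unique)
  have LZ2: "(\<integral>x. (L n x - Z x)\<^sup>2 \<partial>M) \<le> 4 * \<epsilon> n" for n
  proof -
    have "ennreal (\<integral>x. (L n x - Z x)\<^sup>2 \<partial>M) \<le> ennreal (4 * \<epsilon> n)"
      using fatou[of n] by (subst nn_integral_eq_integral[symmetric]) (use L2_square[OF LZ] in auto)
    then show ?thesis using \<epsilon>[of n] by simp
  qed
  have Z: "Z \<in> L2 M" using L2_diff[OF LL2[of 0] LZ[of 0]] by simp
  have XZ: "(\<lambda>x. X x - Z x) \<in> L2 M" by (rule L2_diff[OF X Z])
  \<comment> \<open>\<open>X - Z\<close> is split at \<open>L n\<close>. The first part is almost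
    uncorrelated with \<open>V\<close>, which by Gaussianity bounds its integral against
    \<open>iexp (V x)\<close>; the second part is small in mean.\<close>
  have orth: "(\<integral>x. complex_of_real (X x - Z x) * iexp (V x) \<partial>M) = 0" if V: "V \<in> \<V>" for V
  proof -
    have [measurable]: "V \<in> borel_measurable M" using VL2[OF V] by (rule L2_measurable)
    define k where "k = (1 + (\<integral>x. (V x)\<^sup>2 \<partial>M)) / 2"
    have ie: "integrable M (\<lambda>x. complex_of_real (f x) * iexp (V x))" if "f \<in> L2 M" for f
    proof -
      have [measurable]: "f \<in> borel_measurable M" using that by (rule L2_measurable)
      show ?thesis
        by (rule Bochner_Integration.integrable_bound[OF L2_integrable[OF that]]) (auto simp: norm_mult)
    qed
    have "cmod (\<integral>x. complex_of_real (X x - Z x) * iexp (V x) \<partial>M) \<le> sqrt (\<epsilon> n) * k + 2 * sqrt (\<epsilon> n)" for n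
    proof -
      have "(\<integral>x. complex_of_real (X x - Z x) * iexp (V x) \<partial>M)
          = (\<integral>x. complex_of_real (X x - L n x) * iexp (V x) + complex_of_real (L n x - Z x) * iexp (V x) \<partial>M)"
        by (intro Bochner_Integration.integral_cong refl) (simp add: algebra_simps)
      also have "\<dots> = (\<integral>x. complex_of_real (X x - L n x) * iexp (V x) \<partial>M) + (\<integral>x. complex_of_real (L n x - Z x) * iexp (V x) \<partial>M)"
        by (rule Bochner_Integration.integral_add[OF ie[OF RL2] ie[OF LZ]])
      also have "cmod \<dots> \<le> cmod (\<integral>x. complex_of_real (X x - L n x) * iexp (V x) \<partial>M) + cmod (\<integral>x. complex_of_real (L n x - Z x) * iexp (V x) \<partial>M)"
        by (rule norm_triangle_ineq)
      also have "cmod (\<integral>x. complex_of_real (X x - L n x) * iexp (V x) \<partial>M) \<le> \<bar>\<integral>x. (X x - L n x) * V x \<partial>M\<bar>"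
      proof (rule gaussian_correlation_iexp_bound)
        fix a b
        have "(\<lambda>x. b * V x + (-a) * L n x) \<in> \<V>" by (rule cl[OF clmult[OF V] L])
        from gauss[OF this, of a 1]
        show "centered_gaussian M (\<lambda>x. a * (X x - L n x) + b * V x)" by (simp add: algebra_simps)
      qed
      also have "\<dots> \<le> sqrt (\<epsilon> n) * k" unfolding k_def by (rule corr[OF V])
      also have "cmod (\<integral>x. complex_of_real (L n x - Z x) * iexp (V x) \<partial>M) \<le> (\<integral>x. \<bar>L n x - Z x\<bar> \<partial>M)"
      proof -
        have "cmod (\<integral>x. complex_of_real (L n x - Z x) * iexp (V x) \<partial>M) \<le> (\<integral>x. cmod (complex_of_real (L n x - Z x) * iexp (V x)) \<partial>M)"
          by (rule integral_norm_bound)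
        also have "\<dots> = (\<integral>x. \<bar>L n x - Z x\<bar> \<partial>M)"
          by (simp only: norm_mult norm_exp_i_times norm_of_real mult_1_right)
        finally show ?thesis .
      qed
      also have "\<dots> \<le> 2 * sqrt (\<epsilon> n)"
      proof -
        have "(\<integral>x. \<bar>L n x - Z x\<bar> \<partial>M)\<^sup>2 \<le> 4 * \<epsilon> n"
          using L2_integral_abs_le[OF LZ[of n]] LZ2[of n] by simp
        then have "(\<integral>x. \<bar>L n x - Z x\<bar> \<partial>M) \<le> sqrt (4 * \<epsilon> n)" by (rule real_le_rsqrt)
        then show ?thesis by (simp add: real_sqrt_mult)
      qed
      finally show ?thesis by simp
    qed
    moreover have "(\<lambda>n. sqrt (\<epsilon> n) * k + 2 * sqrt (\<epsilon> n)) \<longlonglongrightarrow> sqrt 0 * k + 2 * sqrt 0"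
      by (intro tendsto_intros \<epsilon>0)
    ultimately have "cmod (\<integral>x. complex_of_real (X x - Z x) * iexp (V x) \<partial>M) \<le> sqrt 0 * k + 2 * sqrt 0"
      by (intro LIMSEQ_le_const) auto
    then show ?thesis by simp
  qed
  have AEZ: "AE x in M. real_cond_exp M F X x = Z x"
  proof (rule F.real_cond_exp_charact)
    show "integrable M X" "integrable M Z" using X Z by (auto intro: L2_integrable)
    fix K assume K: "K \<in> sets F"
    then have KM[measurable]: "K \<in> sets M" using F by (auto simp: subalgebra_def)
    have *: "(\<integral>x. (X x - Z x) * indicator K x \<partial>M) = 0"
    proof (rule integral_indicator_sigma_sets_eq_0_of_fourier[OF L2_integrable[OF XZ] _ z UV cl orth])
      show "\<V> \<subseteq> borel_measurable M" using VL2 L2_measurable by blast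
    qed (use K setsF in auto)
    have I: "integrable M (\<lambda>x. f x * indicator K x)" if "f \<in> L2 M" for f :: "'a \<Rightarrow> real"
      using integrable_mult_indicator[OF KM L2_integrable[OF that]] by (simp add: mult.commute)
    have "(\<integral>x. X x * indicator K x \<partial>M) = (\<integral>x. Z x * indicator K x \<partial>M)"
      using * I[OF X] I[OF Z] by (simp add: left_diff_distrib)
    then show "(\<integral>x\<in>K. X x \<partial>M) = (\<integral>x\<in>K. Z x \<partial>M)"
      by (simp add: set_lebesgue_integral_def mult.commute)
  qed (rule ZF)
  let ?Y = "real_cond_exp M F X"
  have [measurable]: "?Y \<in> borel_measurable M" by simp
  have "integrable M (\<lambda>x. (?Y x)\<^sup>2) \<longleftrightarrow> integrable M (\<lambda>x. (Z x)\<^sup>2)"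
    by (rule integrable_cong_AE) (use AEZ in auto)
  then show YL2: "?Y \<in> L2 M" using L2_square[OF Z] by (simp add: L2_def)
  have "(\<integral>x. (X x - ?Y x)\<^sup>2 \<partial>M) = (\<integral>x. (X x - Z x)\<^sup>2 \<partial>M)"
    by (rule integral_cong_AE) (use AEZ in auto)
  \<comment> \<open>The bound by \<open>c\<close> is known on \<open>\<V>\<close> only and has to be
    carried over from \<open>L n\<close> to \<open>Z\<close>. The difference \<open>Z - L n\<close>
    is measurable for \<open>F\<close>, hence orthogonal to \<open>X - Z\<close>, and Pythagoras
    leaves an excess of at most \<open>4 * \<epsilon> n\<close>.\<close>
  moreover have "c \<le> (\<integral>x. (X x - Z x)\<^sup>2 \<partial>M) + 4 * \<epsilon> n" for n
  proof -
    define D where "D = (\<lambda>x. Z x - L n x)"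
    have DF[measurable]: "D \<in> borel_measurable F" unfolding D_def by measurable
    have D: "D \<in> L2 M" unfolding D_def by (rule L2_diff[OF Z LL2])
    have "(\<integral>x. D x * ?Y x \<partial>M) = (\<integral>x. D x * X x \<partial>M)"
      by (rule F.real_cond_exp_intg(2)) (use L2_mult[OF D X] in auto)
    moreover have "(\<integral>x. D x * ?Y x \<partial>M) = (\<integral>x. D x * Z x \<partial>M)"
      by (rule integral_cong_AE) (use AEZ L2_measurable[OF D] in auto)
    ultimately have "(\<integral>x. D x * (X x - Z x) \<partial>M) = 0"
      using L2_mult[OF D X] L2_mult[OF D Z] by (simp add: right_diff_distrib)
    then have "(\<integral>x. (X x - Z x) * D x \<partial>M) = 0" by (simp add: mult.commute)
    then have "(\<integral>x. ((X x - Z x) + D x)\<^sup>2 \<partial>M) = (\<integral>x. (X x - Z x)\<^sup>2 \<partial>M) + (\<integral>x. (D x)\<^sup>2 \<partial>M)"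
      by (subst L2_square_add[OF XZ D]) simp
    moreover have "c \<le> err (L n)" using c_d d_le[OF L[of n]] by simp
    ultimately show ?thesis
      using LZ2[of n] by (simp add: err_def D_def power2_commute)
  qed
  moreover have "(\<lambda>n. (\<integral>x. (X x - Z x)\<^sup>2 \<partial>M) + 4 * \<epsilon> n) \<longlonglongrightarrow> (\<integral>x. (X x - Z x)\<^sup>2 \<partial>M) + 4 * 0"
    by (intro tendsto_intros \<epsilon>0)
  ultimately show "c \<le> (\<integral>x. (X x - ?Y x)\<^sup>2 \<partial>M)"
    by (intro LIMSEQ_le_const[where X="\<lambda>n. (\<integral>x. (X x - Z x)\<^sup>2 \<partial>M) + 4 * \<epsilon> n"]) auto
qed

subsection \<open>Fractional Brownian motion\<close>

text \<open>The span is not closed: bounds are checked on finite combinations, and the limit is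
  taken in \<open>gaussian_prediction_error\<close>.\<close>

definition lin_combs :: "(real \<Rightarrow> 'a \<Rightarrow> real) \<Rightarrow> real set \<Rightarrow> ('a \<Rightarrow> real) set" where
  "lin_combs B J = {(\<lambda>\<omega>. \<Sum>u\<in>S. c u * B u \<omega>) | S c. finite S \<and> S \<subseteq> J}"

lemma lin_combsE:
  assumes "V \<in> lin_combs B J"
  obtains S c where "finite S" "S \<subseteq> J" "V = (\<lambda>\<omega>. \<Sum>u\<in>S. c u * B u \<omega>)"
  using assms by (auto simp: lin_combs_def)

lemma lin_combsI: "finite S \<Longrightarrow> S \<subseteq> J \<Longrightarrow> (\<lambda>\<omega>. \<Sum>u\<in>S. c u * B u \<omega>) \<in> lin_combs B J"
  by (auto simp: lin_combs_def)

lemma lin_combs_mono: "J \<subseteq> J' \<Longrightarrow> lin_combs B J \<subseteq> lin_combs B J'"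
  by (auto simp: lin_combs_def)

lemma zero_in_lin_combs: "(\<lambda>\<omega>. 0) \<in> lin_combs B J"
  using lin_combsI[of "{}" J] by simp

lemma process_in_lin_combs: "u \<in> J \<Longrightarrow> B u \<in> lin_combs B J"
  using lin_combsI[of "{u}" J "\<lambda>_. 1" B] by simp

lemma lin_combs_add_mult:
  assumes "V \<in> lin_combs B J" "W \<in> lin_combs B J"
  shows "(\<lambda>\<omega>. a * V \<omega> + t * W \<omega>) \<in> lin_combs B J"
proof -
  obtain S c where V: "finite S" "S \<subseteq> J" "V = (\<lambda>\<omega>. \<Sum>u\<in>S. c u * B u \<omega>)"
    using assms(1) by (rule lin_combsE)
  obtain S' c' where W: "finite S'" "S' \<subseteq> J" "W = (\<lambda>\<omega>. \<Sum>u\<in>S'. c' u * B u \<omega>)"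
    using assms(2) by (rule lin_combsE)
  \<comment> \<open>Extending both coefficient functions by zero puts the two sums on the common
    index set \<open>S \<union> S'\<close>.\<close>
  define e where "e = (\<lambda>u. a * (if u \<in> S then c u else 0) + t * (if u \<in> S' then c' u else 0))"
  have "a * V \<omega> + t * W \<omega> = (\<Sum>u\<in>S \<union> S'. e u * B u \<omega>)" for \<omega>
  proof -
    have "V \<omega> = (\<Sum>u\<in>S \<union> S'. (if u \<in> S then c u else 0) * B u \<omega>)"
      unfolding V(3) using V(1) W(1) by (intro sum.mono_neutral_cong_left) auto
    moreover have "W \<omega> = (\<Sum>u\<in>S \<union> S'. (if u \<in> S' then c' u else 0) * B u \<omega>)"
      unfolding W(3) using V(1) W(1) by (intro sum.mono_neutral_cong_left) auto
    ultimately show ?thesis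
      by (simp only: e_def sum_distrib_left distrib_right sum.distrib mult.assoc)
  qed
  then show ?thesis using lin_combsI[of "S \<union> S'" J e B] V W by simp
qed

section \<open>The natural filtration\<close>

lemma natural_filtration_space_sets:
  "space (natural_filtration M B t) = space M"
  "sets (natural_filtration M B t) =
     sigma_sets (space M) (\<Union>u\<in>{0..t}. {B u -` A \<inter> space M | A. A \<in> sets borel})"
proof -
  have "(\<Union>u\<in>{0..t}. {B u -` A \<inter> space M | A. A \<in> sets borel}) \<subseteq> Pow (space M)" by blast
  from sets_measure_of[OF this] space_measure_of[OF this]
  show "space (natural_filtration M B t) = space M"
    "sets (natural_filtration M B t) =
       sigma_sets (space M) (\<Union>u\<in>{0..t}. {B u -` A \<inter> space M | A. A \<in> sets borel})"
    by (simp_all only: natural_filtration_def)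
qed

lemma natural_filtration_measurable:
  assumes "u \<in> {0..t}"
  shows "B u \<in> borel_measurable (natural_filtration M B t)"
proof (rule measurableI)
  fix A :: "real set" assume "A \<in> sets borel"
  then have "B u -` A \<inter> space M \<in> (\<Union>u\<in>{0..t}. {B u -` A \<inter> space M | A. A \<in> sets borel})"
    by (intro UN_I[OF assms] CollectI exI[of _ A] conjI refl)
  then show "B u -` A \<inter> space (natural_filtration M B t) \<in> sets (natural_filtration M B t)"
    unfolding natural_filtration_space_sets by (rule sigma_sets.Basic)
qed simp

lemma subalgebra_natural_filtration:
  assumes "\<And>u. u \<in> {0..t} \<Longrightarrow> B u \<in> borel_measurable M"
  shows "subalgebra M (natural_filtration M B t)"
  unfolding subalgebra_def natural_filtration_space_sets
proof (intro conjI refl sets.sigma_sets_subset UN_least subsetI)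
  fix u K assume u: "u \<in> {0..t}" and "K \<in> {B u -` A \<inter> space M | A. A \<in> sets borel}"
  then obtain A where "K = B u -` A \<inter> space M" "A \<in> sets borel" by blast
  then show "K \<in> sets M" using measurable_sets[OF assms[OF u]] by simp
qed

lemma natural_filtration_mono:
  assumes "s \<le> t"
  shows "subalgebra (natural_filtration M B t) (natural_filtration M B s)"
  unfolding subalgebra_def natural_filtration_space_sets
proof (intro conjI refl sigma_sets_mono')
  have "{0..s} \<subseteq> {0..t}" using assms by simp
  then show "(\<Union>u\<in>{0..s}. {B u -` A \<inter> space M | A. A \<in> sets borel})
      \<subseteq> (\<Union>u\<in>{0..t}. {B u -` A \<inter> space M | A. A \<in> sets borel})"
    by (rule UN_mono) simp
qed

lemma lin_combs_natural_filtration: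
  "lin_combs B {0..t} \<subseteq> borel_measurable (natural_filtration M B t)"
proof
  fix V assume "V \<in> lin_combs B {0..t}"
  then obtain S c where "finite S" "S \<subseteq> {0..t}" and V: "V = (\<lambda>\<omega>. \<Sum>u\<in>S. c u * B u \<omega>)"
    by (rule lin_combsE)
  then show "V \<in> borel_measurable (natural_filtration M B t)"
    unfolding V by (intro borel_measurable_sum borel_measurable_times borel_measurable_const
        natural_filtration_measurable) auto
qed

section \<open>One-step prediction of fractional Brownian motion\<close>

context prob_space
begin

lemma fBm_lin_combs_gaussian:
  assumes "fBm M H T B" "V \<in> lin_combs B {0..T}"
  shows "centered_gaussian M V"
proof -
  obtain S c where "finite S" "S \<subseteq> {0..T}" "V = (\<lambda>\<omega>. \<Sum>u\<in>S. c u * B u \<omega>)"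
    using assms(2) by (rule lin_combsE)
  then show ?thesis using assms(1) unfolding fBm_def by blast
qed

lemma fBm_square_lin_comb:
  assumes B: "fBm M H T B" and S: "finite S" "S \<subseteq> {0..T}"
  shows "(\<integral>\<omega>. (\<Sum>u\<in>S. b u * B u \<omega>)\<^sup>2 \<partial>M) =
    (\<Sum>u\<in>S. \<Sum>v\<in>S. b u * b v * ((u powr (2*H) + v powr (2*H) - \<bar>u - v\<bar> powr (2*H)) / 2))"
proof -
  have I: "integrable M (\<lambda>\<omega>. B u \<omega> * B v \<omega>)"
    and E: "(\<integral>\<omega>. B u \<omega> * B v \<omega> \<partial>M) = (u powr (2*H) + v powr (2*H) - \<bar>u - v\<bar> powr (2*H)) / 2"
    if "u \<in> S" "v \<in> S" for u v
    using B S that unfolding fBm_def by blast+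
  have "(\<integral>\<omega>. (\<Sum>u\<in>S. b u * B u \<omega>)\<^sup>2 \<partial>M) = (\<integral>\<omega>. (\<Sum>u\<in>S. \<Sum>v\<in>S. b u * b v * (B u \<omega> * B v \<omega>)) \<partial>M)"
    unfolding power2_eq_square sum_product by (simp only: ac_simps)
  also have "\<dots> = (\<Sum>u\<in>S. \<Sum>v\<in>S. b u * b v * (\<integral>\<omega>. B u \<omega> * B v \<omega> \<partial>M))"
    using I by (simp add: Bochner_Integration.integral_sum)
  also have "\<dots> = (\<Sum>u\<in>S. \<Sum>v\<in>S. b u * b v * ((u powr (2*H) + v powr (2*H) - \<bar>u - v\<bar> powr (2*H)) / 2))"
    by (intro sum.cong refl) (simp only: E)
  finally show ?thesis .
qed

text \<open>\<open>gaussian_prediction_error\<close> is applied to the finite combinations of values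
  up to time \<open>s\<close>. Since \<open>B s\<close> is one of them, \<open>X - V\<close> is
  \<open>B t\<close> minus a combination of the past, and the covariance bound applies with
  coefficient \<open>1\<close> at \<open>t\<close>.\<close>

lemma fBm_prediction_error:
  assumes B: "fBm M H T B" and H: "0 < H" "H < 1/2" and st: "0 \<le> s" "s < t" "t \<le> T"
  defines "X \<equiv> \<lambda>\<omega>. B t \<omega> - B s \<omega>" and "F \<equiv> natural_filtration M B s"
  shows "real_cond_exp M F X \<in> L2 M"
    and "(1 - 2*H) / 2 * (t - s) powr (2*H) \<le> (\<integral>\<omega>. (X \<omega> - real_cond_exp M F X \<omega>)\<^sup>2 \<partial>M)"
proof -
  define \<V> where "\<V> = lin_combs B {0..s}"
  have sub: "\<V> \<subseteq> lin_combs B {0..T}"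
    unfolding \<V>_def by (rule lin_combs_mono) (use st in auto)
  have X: "X \<in> lin_combs B {0..T}"
    using lin_combs_add_mult[of "B t" B "{0..T}" "B s" 1 "-1"] process_in_lin_combs[of _ "{0..T}" B] st
    by (simp add: X_def)
  have meas: "B u \<in> borel_measurable M" if "u \<in> {0..s}" for u
    using B that st by (auto simp: fBm_def)
  have z: "(\<lambda>x. 0) \<in> \<V>" unfolding \<V>_def by (rule zero_in_lin_combs)
  have UV: "B ` {0..s} \<subseteq> \<V>" unfolding \<V>_def by (auto intro: process_in_lin_combs)
  have cl: "(\<lambda>x. V x + r * u x) \<in> \<V>" if "V \<in> \<V>" "u \<in> \<V>" for V u r
    using lin_combs_add_mult[of V B "{0..s}" u 1 r] that by (simp add: \<V>_def)
  have gauss: "centered_gaussian M (\<lambda>x. a * X x + b * V x)" if "V \<in> \<V>" for V a b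
    by (intro fBm_lin_combs_gaussian[OF B] lin_combs_add_mult X) (use that sub in auto)
  have subF: "subalgebra M F" unfolding F_def by (rule subalgebra_natural_filtration[OF meas])
  have setsF: "sets F = sigma_sets (space M) (\<Union>u\<in>B ` {0..s}. {u -` A \<inter> space M |A. A \<in> sets borel})"
    unfolding F_def natural_filtration_space_sets by simp
  have VF: "\<V> \<subseteq> borel_measurable F"
    unfolding \<V>_def F_def by (rule lin_combs_natural_filtration)
  have lower: "(1 - 2*H) / 2 * (t - s) powr (2*H) \<le> (\<integral>\<omega>. (X \<omega> - V \<omega>)\<^sup>2 \<partial>M)" if "V \<in> \<V>" for V
  proof -
    have "(\<lambda>\<omega>. 1 * V \<omega> + 1 * B s \<omega>) \<in> \<V>"
      using that unfolding \<V>_def using st by (intro lin_combs_add_mult process_in_lin_combs) auto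
    then obtain S c where S: "finite S" "S \<subseteq> {0..s}"
      and V: "(\<lambda>\<omega>. 1 * V \<omega> + 1 * B s \<omega>) = (\<lambda>\<omega>. \<Sum>u\<in>S. c u * B u \<omega>)"
      unfolding \<V>_def by (rule lin_combsE)
    define b where "b = (\<lambda>u. if u = t then 1 else - c u)"
    have tS: "t \<notin> S" using S st by auto
    have "X \<omega> - V \<omega> = (\<Sum>u\<in>insert t S. b u * B u \<omega>)" for \<omega>
    proof -
      have "(\<Sum>u\<in>S. b u * B u \<omega>) = (\<Sum>u\<in>S. - (c u * B u \<omega>))"
        using tS by (intro sum.cong) (auto simp: b_def)
      also have "\<dots> = - (V \<omega> + B s \<omega>)" using fun_cong[OF V, of \<omega>] by (simp add: sum_negf)
      finally show ?thesis using S tS by (simp add: X_def b_def)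
    qed
    moreover have "insert t S \<subseteq> {0..T}" using S st by force
    ultimately have "(\<integral>\<omega>. (X \<omega> - V \<omega>)\<^sup>2 \<partial>M) = (\<Sum>u\<in>insert t S. \<Sum>v\<in>insert t S.
       b u * b v * ((u powr (2*H) + v powr (2*H) - \<bar>u - v\<bar> powr (2*H)) / 2))"
      using fBm_square_lin_comb[OF B, of "insert t S" b] S(1) by simp
    then show ?thesis
      using fBm_covariance_form_lower_bound[OF H S st(1,2), of b] by (simp add: b_def)
  qed
  show "real_cond_exp M F X \<in> L2 M"
    by (rule gaussian_prediction_error(1)[OF gauss z UV cl subF setsF VF lower])
  show "(1 - 2*H) / 2 * (t - s) powr (2*H) \<le> (\<integral>\<omega>. (X \<omega> - real_cond_exp M F X \<omega>)\<^sup>2 \<partial>M)"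
    by (rule gaussian_prediction_error(2)[OF gauss z UV cl subF setsF VF lower])
qed

end

subsection \<open>The compensator\<close>

lemma L2_square_sum_orthogonal:
  assumes "finite I" "\<And>i. i \<in> I \<Longrightarrow> N i \<in> L2 M"
    and "\<And>i j. i \<in> I \<Longrightarrow> j \<in> I \<Longrightarrow> i \<noteq> j \<Longrightarrow> (\<integral>x. N i x * N j x \<partial>M) = 0"
  shows "(\<integral>x. (\<Sum>i\<in>I. N i x)\<^sup>2 \<partial>M) = (\<Sum>i\<in>I. \<integral>x. (N i x)\<^sup>2 \<partial>M)"
  using assms
proof (induction I rule: finite_induct)
  case (insert i I)
  have "(\<integral>x. N i x * (\<Sum>j\<in>I. N j x) \<partial>M) = (\<Sum>j\<in>I. \<integral>x. N i x * N j x \<partial>M)"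
    unfolding sum_distrib_left
    by (rule Bochner_Integration.integral_sum) (rule L2_mult; rule insert.prems(1); simp)
  also have "\<dots> = 0"
  proof (rule sum.neutral, rule ballI)
    fix j assume "j \<in> I"
    then show "(\<integral>x. N i x * N j x \<partial>M) = 0" using insert.hyps by (intro insert.prems(2)) auto
  qed
  finally have cross: "(\<integral>x. N i x * (\<Sum>j\<in>I. N j x) \<partial>M) = 0" .
  have NI: "N i \<in> L2 M" "(\<lambda>x. \<Sum>j\<in>I. N j x) \<in> L2 M"
    by (auto intro: L2_sum insert.prems(1))
  have IH: "(\<integral>x. (\<Sum>j\<in>I. N j x)\<^sup>2 \<partial>M) = (\<Sum>j\<in>I. \<integral>x. (N j x)\<^sup>2 \<partial>M)"
    by (rule insert.IH) (auto intro: insert.prems)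
  show ?case
    using L2_square_add[OF NI] insert.hyps by (simp add: cross IH)
qed simp


text \<open>Conditional expectation acts as an orthogonal projection. With \<open>Y\<close> an
  earlier prediction error, known at the start of a later step, this makes different prediction
  errors orthogonal.\<close>

lemma (in prob_space) integral_mult_diff_cond_exp_eq_0:
  assumes F: "subalgebra M F" and Y: "Y \<in> L2 M" "Y \<in> borel_measurable F"
    and X: "X \<in> L2 M" "real_cond_exp M F X \<in> L2 M"
  shows "(\<integral>x. Y x * (X x - real_cond_exp M F X x) \<partial>M) = 0"
proof -
  interpret F: finite_measure_subalgebra M F
    by unfold_locales (rule F)
  have "(\<integral>x. Y x * real_cond_exp M F X x \<partial>M) = (\<integral>x. Y x * X x \<partial>M)"
    by (rule F.real_cond_exp_intg(2)) (use L2_mult[OF Y(1) X(1)] Y(2) L2_measurable[OF X(1)] in auto)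
  then show ?thesis
    using L2_mult[OF Y(1) X(1)] L2_mult[OF Y(1) X(2)] by (simp add: right_diff_distrib)
qed

section \<open>Points and mesh of a partition\<close>

text \<open>Since \<open>0 < T\<close>, the set has at least two points, so
  \<open>card P - 1\<close> is the last index of the sorted list and not a truncated subtraction.
  The end points get the extreme indices because the list increases strictly inside
  \<open>{0..T}\<close>.\<close>

lemma partition_points:
  assumes P: "is_partition T P" and T: "0 < T"
  shows "0 < part_len P" and "part_pt P 0 = 0" and "part_pt P (part_len P) = T"
    and "\<And>k. k \<le> part_len P \<Longrightarrow> part_pt P k \<in> {0..T}"
    and "\<And>j k. j < k \<Longrightarrow> k \<le> part_len P \<Longrightarrow> part_pt P j < part_pt P k"
proof -
  let ?l = "sorted_list_of_set P"
  have fin: "finite P" and sub: "P \<subseteq> {0..T}" and "0 \<in> P" "T \<in> P"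
    using P by (auto simp: is_partition_def)
  have l: "set ?l = P" "length ?l = card P" "sorted_wrt (<) ?l"
    using fin by simp_all
  have "card {0, T} \<le> card P" using fin \<open>0 \<in> P\<close> \<open>T \<in> P\<close> by (intro card_mono) auto
  then have card: "2 \<le> card P" using T by simp
  then show n: "0 < part_len P" by (simp add: part_len_def)
  show in_T: "part_pt P k \<in> {0..T}" if "k \<le> part_len P" for k
  proof -
    have "?l ! k \<in> set ?l" using that card l(2) by (intro nth_mem) (simp add: part_len_def)
    then show ?thesis using sub l(1) by (auto simp: part_pt_def)
  qed
  show mono: "part_pt P j < part_pt P k" if "j < k" "k \<le> part_len P" for j k
    using sorted_wrt_nth_less[OF l(3), of j k] that card l(2) by (simp add: part_pt_def part_len_def)
  have ex: "\<exists>k\<le>part_len P. part_pt P k = x" if "x \<in> P" for x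
  proof -
    have "x \<in> set ?l" by (simp only: l(1) that)
    then obtain k where "k < length ?l" "?l ! k = x" by (auto simp only: in_set_conv_nth)
    then show ?thesis using l(2) by (intro exI[of _ k]) (auto simp: part_pt_def part_len_def)
  qed
  obtain k where k: "k \<le> part_len P" "part_pt P k = 0" using ex[OF \<open>0 \<in> P\<close>] by blast
  then show "part_pt P 0 = 0" using mono[of 0 k] in_T[of 0] by (cases "k = 0") auto
  obtain k where k: "k \<le> part_len P" "part_pt P k = T" using ex[OF \<open>T \<in> P\<close>] by blast
  then show "part_pt P (part_len P) = T"
    using mono[of k "part_len P"] in_T[of "part_len P"] by (cases "k = part_len P") auto
qed

text \<open>With \<open>0 < T\<close> the default branch of \<open>mesh\<close> does not occur.
  Strict positivity lets powers of the mesh be inverted later.\<close>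

lemma mesh_bounds:
  assumes P: "is_partition T P" and T: "0 < T"
  shows "0 < mesh P"
    and "\<And>k. k \<in> {1..part_len P} \<Longrightarrow> part_pt P k - part_pt P (k - 1) \<le> mesh P"
proof -
  have mesh: "mesh P = Max ((\<lambda>k. part_pt P k - part_pt P (k - 1)) ` {1..part_len P})"
    using partition_points(1)[OF P T] by (simp add: mesh_def)
  show le: "part_pt P k - part_pt P (k - 1) \<le> mesh P" if "k \<in> {1..part_len P}" for k
    unfolding mesh by (rule Max_ge) (use that in auto)
  have "0 < part_pt P 1 - part_pt P (1 - 1)"
    using partition_points(1,5)[OF P T] by simp
  also have "\<dots> \<le> mesh P"
    by (rule le) (use partition_points(1)[OF P T] in simp)
  finally show "0 < mesh P" .
qed

section \<open>The second moment of the compensator\<close>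

text \<open>The errors \<open>N k\<close> are orthogonal with sum \<open>S - A\<close>, where
  \<open>S\<close> is the total increment and \<open>A\<close> the compensator. Bounding the square
  of \<open>S - A\<close> by twice the sum of the two squares halves the constant
  \<open>(1 - 2*H) / 2\<close> and subtracts the second moment of \<open>S\<close>. A negative
  left-hand side is sent to \<open>0\<close> by \<open>ennreal\<close>.\<close>

lemma (in prob_space) compensator_second_moment_lower_bound:
  assumes B: "fBm M H T B" and H: "0 < H" "H < 1/2" and T: "0 < T" and P: "is_partition T P"
  shows "ennreal ((1 - 2*H) / 4 * T * inverse (mesh P powr (1 - 2*H)) - T powr (2*H))
    \<le> (\<integral>\<^sup>+ \<omega>. ennreal ((compensator_T M B P \<omega>)\<^sup>2) \<partial>M)"
proof -
  define n where "n = part_len P"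
  define p where "p = part_pt P"
  define F where "F = (\<lambda>k. natural_filtration M B (p (k - 1)))"
  define X where "X = (\<lambda>k \<omega>. B (p k) \<omega> - B (p (k - 1)) \<omega>)"
  define D where "D = (\<lambda>k. real_cond_exp M (F k) (X k))"
  define N where "N = (\<lambda>k \<omega>. X k \<omega> - D k \<omega>)"
  define m where "m = mesh P"
  define c where "c = (1 - 2*H) / 2"
  have c: "c > 0" using H by (simp add: c_def)
  have n: "0 < n" "p 0 = 0" "p n = T" and pT: "\<And>k. k \<le> n \<Longrightarrow> p k \<in> {0..T}"
    and pless: "\<And>j k. j < k \<Longrightarrow> k \<le> n \<Longrightarrow> p j < p k"
    using partition_points[OF P T] by (auto simp: n_def p_def)
  have m: "0 < m" "\<And>k. k \<in> {1..n} \<Longrightarrow> p k - p (k - 1) \<le> m"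
    using mesh_bounds[OF P T] by (auto simp: m_def n_def p_def)
  have BL2: "B u \<in> L2 M" if "u \<in> {0..T}" for u
    using fBm_lin_combs_gaussian[OF B process_in_lin_combs[OF that]]
    by (rule centered_gaussian_square_integrable)
  have XL2: "X k \<in> L2 M" if "k \<in> {1..n}" for k
    unfolding X_def by (intro L2_diff BL2 pT) (use that in auto)
  have step: "0 \<le> p (k - 1)" "p (k - 1) < p k" "p k \<le> T" if "k \<in> {1..n}" for k
    using pT[of k] pT[of "k - 1"] pless[of "k - 1" k] that by auto
  have DL2: "D k \<in> L2 M" and err: "c * (p k - p (k - 1)) powr (2*H) \<le> (\<integral>\<omega>. (N k \<omega>)\<^sup>2 \<partial>M)"
    if "k \<in> {1..n}" for k
    using fBm_prediction_error[OF B H step[OF that]]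
    by (simp_all add: D_def X_def F_def N_def c_def)
  have NL2: "N k \<in> L2 M" if "k \<in> {1..n}" for k
    unfolding N_def by (rule L2_diff[OF XL2[OF that] DL2[OF that]])
  have sub: "subalgebra M (natural_filtration M B t)" if "t \<le> T" for t
    by (rule subalgebra_natural_filtration) (use that B in \<open>auto simp: fBm_def\<close>)
  \<comment> \<open>For \<open>i < j\<close>, the error \<open>N i\<close> is already measurable at
    time \<open>p (j - 1)\<close>; the two times \<open>p i\<close> and \<open>p (j - 1)\<close>
    coincide for consecutive steps.\<close>
  have orth: "(\<integral>\<omega>. N i \<omega> * N j \<omega> \<partial>M) = 0" if ij: "i \<in> {1..n}" "j \<in> {1..n}" "i < j" for i j
  proof -
    have le: "p i \<le> p (j - 1)" "p (i - 1) \<le> p (j - 1)"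
      using pless[of i "j - 1"] pless[of "i - 1" "j - 1"] ij by (cases "i = j - 1"; force)+
    have "N i \<in> borel_measurable (F j)"
    proof -
      have [measurable]: "B (p i) \<in> borel_measurable (F j)" "B (p (i - 1)) \<in> borel_measurable (F j)"
        unfolding F_def by (intro natural_filtration_measurable; use le step[OF ij(1)] in auto)+
      have "subalgebra (F j) (F i)" unfolding F_def by (rule natural_filtration_mono[OF le(2)])
      then have [measurable]: "D i \<in> borel_measurable (F j)"
        unfolding D_def by (rule measurable_from_subalg) simp
      show ?thesis unfolding N_def X_def by measurable
    qed
    moreover have "subalgebra M (F j)" unfolding F_def by (rule sub) (use step[OF ij(2)] in auto)
    ultimately show ?thesis
      using integral_mult_diff_cond_exp_eq_0[of "F j" "N i" "X j"] NL2 XL2 DL2 ij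
      by (simp add: N_def D_def)
  qed
  define A where "A = compensator_T M B P"
  have A: "A = (\<lambda>\<omega>. \<Sum>k\<in>{1..n}. D k \<omega>)"
    unfolding A_def compensator_T_def D_def F_def X_def n_def p_def by simp
  have AL2: "A \<in> L2 M" unfolding A by (rule L2_sum[OF DL2])
  define S where "S = (\<lambda>\<omega>. B T \<omega> - B 0 \<omega>)"
  have SL2: "S \<in> L2 M" unfolding S_def using T by (intro L2_diff BL2) auto
  have sumN: "(\<Sum>k\<in>{1..n}. N k \<omega>) = S \<omega> - A \<omega>" for \<omega>
    using sum_telescope''[of 0 n "\<lambda>k. B (p k) \<omega>"] n
    by (simp add: N_def X_def A S_def sum_subtractf)
  have ES: "(\<integral>\<omega>. (S \<omega>)\<^sup>2 \<partial>M) = T powr (2*H)"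
  proof -
    have "S \<omega> = (\<Sum>u\<in>{0, T}. (if u = T then 1 else -1) * B u \<omega>)" for \<omega>
      using T by (simp add: S_def)
    then show ?thesis
      using fBm_square_lin_comb[OF B, of "{0, T}" "\<lambda>u. if u = T then 1 else -1"] T by simp
  qed
  \<comment> \<open>Writing \<open>T\<close> as the sum of the steps reduces the comparison to a
    single step.\<close>
  have "c * (T * inverse (m powr (1 - 2*H))) = (\<Sum>k\<in>{1..n}. c * ((p k - p (k - 1)) * inverse (m powr (1 - 2*H))))"
    using sum_telescope''[of 0 n p] n by (simp flip: sum_distrib_left sum_distrib_right)
  also have "\<dots> \<le> (\<Sum>k\<in>{1..n}. c * (p k - p (k - 1)) powr (2*H))"
  proof (intro sum_mono mult_left_mono)
    fix k assume k: "k \<in> {1..n}"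
    define \<delta> where "\<delta> = p k - p (k - 1)"
    have \<delta>: "0 < \<delta>" "\<delta> \<le> m" using step[OF k] m(2)[OF k] by (auto simp: \<delta>_def)
    \<comment> \<open>\<open>\<delta> powr (2*H)\<close> is \<open>\<delta>\<close> divided by
      \<open>\<delta> powr (1 - 2*H)\<close>. As this exponent is positive, replacing
      \<open>\<delta>\<close> by the larger \<open>m\<close> in the divisor can only lower the
      quotient.\<close>
    have "\<delta> * inverse (m powr (1 - 2*H)) \<le> \<delta> * inverse (\<delta> powr (1 - 2*H))"
      using \<delta> H by (intro mult_left_mono le_imp_inverse_le powr_mono2) auto
    also have "\<dots> = \<delta> powr 1 / \<delta> powr (1 - 2*H)" using \<delta> by (simp add: divide_inverse)
    also have "\<dots> = \<delta> powr (1 - (1 - 2*H))" by (rule powr_diff[symmetric])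
    also have "\<dots> = \<delta> powr (2*H)" by simp
    finally show "(p k - p (k - 1)) * inverse (m powr (1 - 2*H)) \<le> (p k - p (k - 1)) powr (2*H)"
      by (simp add: \<delta>_def)
  qed (use c in simp)
  also have "\<dots> \<le> (\<Sum>k\<in>{1..n}. \<integral>\<omega>. (N k \<omega>)\<^sup>2 \<partial>M)"
    by (rule sum_mono[OF err])
  also have "\<dots> = (\<integral>\<omega>. (\<Sum>k\<in>{1..n}. N k \<omega>)\<^sup>2 \<partial>M)"
  proof (rule L2_square_sum_orthogonal[symmetric])
    show "(\<integral>\<omega>. N i \<omega> * N j \<omega> \<partial>M) = 0" if "i \<in> {1..n}" "j \<in> {1..n}" "i \<noteq> j" for i j
      using orth[of i j] orth[of j i] that by (cases "i < j") (auto simp: mult.commute)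
  qed (use NL2 in auto)
  also have "\<dots> \<le> (\<integral>\<omega>. 2 * (S \<omega>)\<^sup>2 + 2 * (A \<omega>)\<^sup>2 \<partial>M)"
    unfolding sumN
  proof (rule integral_mono)
    show "integrable M (\<lambda>\<omega>. (S \<omega> - A \<omega>)\<^sup>2)" by (rule L2_square[OF L2_diff[OF SL2 AL2]])
    show "integrable M (\<lambda>\<omega>. 2 * (S \<omega>)\<^sup>2 + 2 * (A \<omega>)\<^sup>2)"
      using L2_square[OF SL2] L2_square[OF AL2] by simp
    show "(S \<omega> - A \<omega>)\<^sup>2 \<le> 2 * (S \<omega>)\<^sup>2 + 2 * (A \<omega>)\<^sup>2" for \<omega>
      using zero_le_power2[of "S \<omega> + A \<omega>"] by (simp add: power2_sum power2_diff)
  qed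
  also have "\<dots> = 2 * T powr (2*H) + 2 * (\<integral>\<omega>. (A \<omega>)\<^sup>2 \<partial>M)"
    using L2_square[OF SL2] L2_square[OF AL2] by (simp add: ES)
  finally have "(1 - 2*H) / 4 * T * inverse (m powr (1 - 2*H)) - T powr (2*H) \<le> (\<integral>\<omega>. (A \<omega>)\<^sup>2 \<partial>M)"
    by (simp add: c_def)
  then show ?thesis
    unfolding m_def A_def using L2_square[OF AL2]
    by (subst nn_integral_eq_integral) (auto simp: A_def intro: ennreal_leI)
qed

theorem theorem2p4:
  fixes M :: "'a measure" and H T :: real and B :: "real \<Rightarrow> 'a \<Rightarrow> real"
    and \<theta> :: "nat \<Rightarrow> real set"
  assumes "prob_space M"
    and "0 < H" and "H < 1/2" and "0 < T"
    and "fBm M H T B"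
    and "normally_condensing T \<theta>"
  shows "(SUP n. \<integral>\<^sup>+ \<omega>. ennreal ((compensator_T M B (\<theta> n) \<omega>)\<^sup>2) \<partial>M) = \<infinity>"
proof -
  interpret prob_space M by fact
  have P: "is_partition T (\<theta> n)" for n
    using \<open>normally_condensing T \<theta>\<close> by (simp add: normally_condensing_def)
  have mesh0: "(\<lambda>n. mesh (\<theta> n)) \<longlonglongrightarrow> 0"
    using \<open>normally_condensing T \<theta>\<close> by (auto simp: normally_condensing_def)
  have pos: "0 < mesh (\<theta> n)" for n using mesh_bounds(1)[OF P \<open>0 < T\<close>] .
  \<comment> \<open>Since \<open>H < 1/2\<close>, the exponent is positive and the power of the mesh
    tends to \<open>0\<close>; the mesh being positive, the inverse tends to plus infinity.\<close>
  have "((\<lambda>n. mesh (\<theta> n) powr (1 - 2*H)) \<longlongrightarrow> 0 powr (1 - 2*H)) sequentially"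
    using \<open>H < 1/2\<close>
    by (intro tendsto_powr' mesh0 tendsto_const) (simp add: always_eventually less_imp_le[OF pos])
  then have lim: "filterlim (\<lambda>n. inverse (mesh (\<theta> n) powr (1 - 2*H))) at_top sequentially"
    by (intro filterlim_inverse_at_top) (use less_imp_neq[OF pos] in auto)
  define a where "a = (1 - 2*H) / 4 * T"
  have a: "a > 0" using assms by (simp add: a_def)
  have "\<exists>n. of_nat k \<le> (\<integral>\<^sup>+ \<omega>. ennreal ((compensator_T M B (\<theta> n) \<omega>)\<^sup>2) \<partial>M)" for k
  proof -
    \<comment> \<open>The threshold is what the lower bound, solved for the inverse power of the
      mesh, requires in order to reach \<open>k\<close>.\<close>
    have "\<forall>\<^sub>F n in sequentially. (real k + T powr (2*H)) / a \<le> inverse (mesh (\<theta> n) powr (1 - 2*H))"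
      using lim by (simp add: filterlim_at_top)
    then obtain n where "(real k + T powr (2*H)) / a \<le> inverse (mesh (\<theta> n) powr (1 - 2*H))"
      by (auto simp: eventually_sequentially)
    then have "real k \<le> (1 - 2*H) / 4 * T * inverse (mesh (\<theta> n) powr (1 - 2*H)) - T powr (2*H)"
      using a unfolding a_def[symmetric] by (simp add: pos_divide_le_eq mult.commute)
    then have "of_nat k \<le> ennreal ((1 - 2*H) / 4 * T * inverse (mesh (\<theta> n) powr (1 - 2*H)) - T powr (2*H))"
      unfolding ennreal_of_nat_eq_real_of_nat by (rule ennreal_leI)
    also have "\<dots> \<le> (\<integral>\<^sup>+ \<omega>. ennreal ((compensator_T M B (\<theta> n) \<omega>)\<^sup>2) \<partial>M)"
      using compensator_second_moment_lower_bound assms P by blast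
    finally show ?thesis by blast
  qed
  then have "(SUP n. \<integral>\<^sup>+ \<omega>. ennreal ((compensator_T M B (\<theta> n) \<omega>)\<^sup>2) \<partial>M) = top"
    by (intro ennreal_SUP_eq_top) auto
  then show ?thesis by (simp add: infinity_ennreal_def)
qed

end
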